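(* Let $n\ge2$, $2\le a\le n$ and $1\le i<j\le n$. Let $E_{j,i}(1,a)=\mathbb P[w_1=j,\ w_a=i]$, where $w=(w_1,\dots,w_n)$ is distributed according to the stationary distribution of the multispecies TASEP on a ring with $n$ sites of type $(1,1,\dots,1)$. Then $$E_{j,i}(1,a)=\frac{Y^{a-1}_{n-i,\,n-j+1}(n-1)}{\binom n{i-1}\binom n{j-1}}-\frac{Y^{a-1}_{n-i,\,n-j}(n-1)}{\binom n{i-1}\binom n{j}}-\frac{Y^{a-1}_{n-i-1,\,n-j+1}(n-1)}{\binom n{i}\binom n{j-1}}+\frac{Y^{a-1}_{n-i-1,\,n-j}(n-1)}{\binom n{i}\binom n{j}}.$$
   Context: Multispecies TASEP on a ring with $n$ sites of type $(1,\dots,1)$: the states are the permutations $w=(w_1,\dots,w_n)$ of $\{1,\dots,n\}$, with positions taken cyclically modulo $n$ ($w_i$ is the species of the particle at site $i$). It is the continuous-time Markov chain in which every particle carries an independent rate-$1$ exponential clock; when the clock of the particle of species $j$ rings, it exchanges positions with the particle of species $k$ immediately to its left if $k>j$, and nothing happens otherwise. It has a unique stationary distribution. A semistandard Young tableau (SSYT) is a filling of the boxes of a Young diagram with positive integers that is strictly increasing down columns and weakly increasing along rows. $Y_{r,l}^{\beta}(m)$ denotes the number of SSYTs whose shape has two columns, of lengths $r\ge l$, with no entry exceeding $m$, and such that the number $\beta$ appears somewhere in the second column (the one of length $l$). In particular it is $0$ if $l=0$, and it is taken to be $0$ if $r<l$. *)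

theory Defs
  imports "HOL-Probability.Probability" "HOL-Combinatorics.Permutations"
begin

section \<open>The multispecies TASEP on a ring, type (1,...,1)\<close>

text \<open>A state is a function w with w permutes {1..n}; w p is the species of the particle at
  site p. (Outside {1..n} such a w is the identity, so states are in bijection with the
  permutations of {1..n}.)\<close>

definition tasep_states :: "nat \<Rightarrow> (nat \<Rightarrow> nat) set" where
  "tasep_states n = {w. w permutes {1..n}}"

definition left_site :: "nat \<Rightarrow> nat \<Rightarrow> nat" where
  "left_site n p = (if p = 1 then n else p - 1)"

definition swap_left :: "nat \<Rightarrow> nat \<Rightarrow> (nat \<Rightarrow> nat) \<Rightarrow> (nat \<Rightarrow> nat)" where
  "swap_left n p w = w(p := w (left_site n p), left_site n p := w p)"

text \<open>Each particle rings at rate 1, so the rate of jumping from w to v is the number of sites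
  whose particle, upon ringing, performs an exchange that turns w into v.\<close>

definition tasep_rate :: "nat \<Rightarrow> (nat \<Rightarrow> nat) \<Rightarrow> (nat \<Rightarrow> nat) \<Rightarrow> real" where
  "tasep_rate n w v =
     real (card {p \<in> {1..n}. w (left_site n p) > w p \<and> v = swap_left n p w})"

definition tasep_generator :: "nat \<Rightarrow> (nat \<Rightarrow> nat) \<Rightarrow> (nat \<Rightarrow> nat) \<Rightarrow> real" where
  "tasep_generator n w v =
     (if w = v then - (\<Sum>u \<in> tasep_states n - {w}. tasep_rate n w u) else tasep_rate n w v)"

definition tasep_stationary :: "nat \<Rightarrow> (nat \<Rightarrow> nat) pmf \<Rightarrow> bool" where
  "tasep_stationary n \<pi> \<longleftrightarrow>
     set_pmf \<pi> \<subseteq> tasep_states n \<and>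
     (\<forall>v \<in> tasep_states n. (\<Sum>w \<in> tasep_states n. pmf \<pi> w * tasep_generator n w v) = 0)"


section \<open>Semistandard Young tableaux with two columns\<close>

text \<open>Boxes are pairs (row, column), numbered from 1. A tableau is extended by 0 outside its
  diagram, so that counting these functions counts fillings of the diagram.\<close>

definition semistandard :: "(nat \<times> nat) set \<Rightarrow> (nat \<times> nat \<Rightarrow> nat) \<Rightarrow> bool" where
  "semistandard D T \<longleftrightarrow>
     (\<forall>b \<in> D. T b \<ge> 1) \<and> (\<forall>b. b \<notin> D \<longrightarrow> T b = 0) \<and>
     (\<forall>x x' y. (x, y) \<in> D \<longrightarrow> (x', y) \<in> D \<longrightarrow> x < x' \<longrightarrow> T (x, y) < T (x', y)) \<and>
     (\<forall>x y y'. (x, y) \<in> D \<longrightarrow> (x, y') \<in> D \<longrightarrow> y < y' \<longrightarrow> T (x, y) \<le> T (x, y'))"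

definition two_columns :: "nat \<Rightarrow> nat \<Rightarrow> (nat \<times> nat) set" where
  "two_columns r l = {1..r} \<times> {1} \<union> {1..l} \<times> {2}"

definition Y :: "nat \<Rightarrow> nat \<Rightarrow> nat \<Rightarrow> nat \<Rightarrow> nat" where
  "Y r l \<beta> m =
     (if r < l then 0
      else card {T. semistandard (two_columns r l) T \<and> (\<forall>b \<in> two_columns r l. T b \<le> m) \<and>
                    (\<exists>x \<in> {1..l}. T (x, 2) = \<beta>)})"

end

theory Submission
  imports Defs "HOL-Combinatorics.Multiset_Permutations"
begin

text \<open>For thresholds \<open>s < t\<close>, lump the species into the classes 1 (at most \<open>s\<close>), 2 (up to \<open>t\<close>) and 3.
  The stationary law of the lumped chain is proportional to the number of two-line queues (arrivals
  above, services below) that produce a given word: this weight obeys the cancellation rules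
  \<open>31 \<rightarrow> 3 + 1\<close>, \<open>32 \<rightarrow> 2\<close>, \<open>21 \<rightarrow> 2\<close>, from which stationarity follows by a telescoping sum around
  the ring. Given class 2 at site \<open>a\<close> and class 3 at site 1, the queue is empty at \<open>a\<close>; read
  backwards from there, it is a pair of sequences in which the services dominate the arrivals, and
  there is no service at step \<open>a - 1\<close>. The complements of the two sequences are the columns of a
  tableau counted by \<open>Y (n - s - 1) (n - t) (a - 1) (n - 1)\<close>, so the probability of this event is
  that number divided by the number of two-line queues. The theorem is the mixed difference of
  this formula in \<open>s\<close> and \<open>t\<close>.\<close>

section \<open>Two-line queue weights of ring words\<close>

text \<open>Letters 1, 2, 3 at a step of the queue stand for a used service, an unused service and no
  service, so \<open>queue_count u q\<close> counts the arrival patterns that take the queue length from \<open>q\<close> to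
  0 while producing the word \<open>u\<close>.\<close>

primrec queue_count :: "nat list \<Rightarrow> nat \<Rightarrow> nat" where
  "queue_count [] q = of_bool (q = 0)"
| "queue_count (x # u) q =
     (if x = 1 then queue_count u q + (if q = 0 then 0 else queue_count u (q - 1))
      else if x = 2 then (if q = 0 then queue_count u 0 else 0)
      else queue_count u q + queue_count u (Suc q))"

lemma queue_count_append_2: "queue_count (u @ 2 # v) q = queue_count u q * queue_count v 0"
  by (induction u arbitrary: q) (auto simp: algebra_simps)

lemma queue_count_append_cong:
  assumes "\<And>q. queue_count x q = queue_count y q"
  shows "queue_count (u @ x) q = queue_count (u @ y) q"
  by (induction u arbitrary: q) (auto simp: assms)

text \<open>A prefix acts linearly on the function of \<open>q\<close> given by the rest of the
  word, so a local relation that holds for every queue length survives any prefix.\<close>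

lemma queue_count_append_add:
  assumes "\<And>q. queue_count x q = queue_count y q + queue_count z q"
  shows "queue_count (u @ x) q = queue_count (u @ y) q + queue_count (u @ z) q"
  by (induction u arbitrary: q) (auto simp: assms)

lemma queue_count_0_pos: "queue_count u 0 > 0"
  by (induction u) auto

text \<open>An unused service means an empty queue, so the ring can be cut open at any letter 2.\<close>

definition ring_weight :: "nat list \<Rightarrow> nat" where
  "ring_weight l =
     queue_count (tl (dropWhile (\<lambda>x. x \<noteq> 2) l) @ takeWhile (\<lambda>x. x \<noteq> 2) l) 0"

lemma ring_weight_pos: "ring_weight l > 0"
  by (simp add: ring_weight_def queue_count_0_pos)

text \<open>By \<open>queue_count_append_2\<close>, opening the ring at another 2 only swaps two
  factors, so the choice of the first 2 in \<open>ring_weight\<close> is immaterial.\<close>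

lemma ring_weight_split: "ring_weight (u @ 2 # v) = queue_count (v @ u) 0"
proof -
  have first: "ring_weight (u @ 2 # v) = queue_count (v @ u) 0" if "2 \<notin> set u" for u v
  proof -
    from that have "takeWhile (\<lambda>x. x \<noteq> 2) (u @ 2 # v) = u"
      and "dropWhile (\<lambda>x. x \<noteq> 2) (u @ 2 # v) = 2 # v"
      by (auto simp: takeWhile_append dropWhile_append)
    then show ?thesis by (simp add: ring_weight_def)
  qed
  show ?thesis
  proof (cases "2 \<in> set u")
    case True
    then obtain x y where u: "u = x @ 2 # y" "2 \<notin> set x"
      by (meson split_list_first)
    have "ring_weight (u @ 2 # v) = queue_count (y @ 2 # v @ x) 0"
      using first[of x "y @ 2 # v"] u by simp
    also have "\<dots> = queue_count ((v @ x) @ 2 # y) 0"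
      by (simp only: queue_count_append_2 mult.commute)
    finally show ?thesis using u by simp
  qed (simp add: first)
qed

lemma ring_weight_rotate:
  assumes "2 \<in> set (x @ y)"
  shows "ring_weight (x @ y) = ring_weight (y @ x)"
proof -
  have *: "ring_weight (x @ y) = ring_weight (y @ x)" if x: "2 \<in> set x" for x y
  proof -
    from x obtain u v where "x = u @ 2 # v" by (meson split_list)
    then show ?thesis
      using ring_weight_split[of u "v @ y"] ring_weight_split[of "y @ u" v] by simp
  qed
  show ?thesis using * assms by (metis Un_iff set_append)
qed

text \<open>The letters 3 and 1 act on functions of the queue length as 1 + S and 1 + T, where S and
  T are the two shifts and S T = 1. Hence (1 + S)(1 + T) = (1 + S) + (1 + T), the relation DE = D +
  E of the matrix product ansatz. A letter 2 outside the pair provides a common place to cut all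
  three rings.\<close>

lemma ring_weight_31:
  assumes "2 \<in> set (u @ v)"
  shows "ring_weight (u @ 3 # 1 # v) = ring_weight (u @ 3 # v) + ring_weight (u @ 1 # v)"
proof -
  from assms obtain c d where cd: "v @ u = c @ 2 # d"
    by (metis Un_iff in_set_conv_decomp set_append)
  have rot: "ring_weight (u @ w @ v) = queue_count (d @ w @ c) 0" for w
  proof -
    have "ring_weight (u @ w @ v) = ring_weight (w @ v @ u)"
      using ring_weight_rotate[of u "w @ v"] assms by auto
    then show ?thesis
      using ring_weight_split[of "w @ c" d] cd by simp
  qed
  have "queue_count (3 # 1 # c) q = queue_count (3 # c) q + queue_count (1 # c) q" for q
    by simp
  from queue_count_append_add[OF this]
  show ?thesis using rot[of "[3,1]"] rot[of "[3]"] rot[of "[1]"] by simp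
qed

text \<open>The queue must be empty at the 2, so nothing can arrive at the preceding step, which has
  no service.\<close>

lemma ring_weight_32: "ring_weight (u @ 3 # 2 # v) = ring_weight (u @ 2 # v)"
  using ring_weight_split[of "u @ [3]" v] ring_weight_split[of u v]
    queue_count_append_cong[of "[3]" "[]" "v @ u" 0] by simp

text \<open>After the 2 the queue is empty, so a used service can only take a customer arriving at
  that very step.\<close>

lemma ring_weight_21: "ring_weight (u @ 2 # 1 # v) = ring_weight (u @ 2 # v)"
  using ring_weight_split[of u "1 # v"] ring_weight_split[of u v] by simp

text \<open>These scalars combine the three cancellation rules into the single formula
  \<open>flux_ring_weight\<close>; they play the role of the hat matrices in the matrix product
  ansatz.\<close>

definition letter_sign :: "nat \<Rightarrow> real" where
  "letter_sign x = (if x = 1 then 1 else if x = 3 then - 1 else 0)"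

text \<open>The net gain of the word \<open>l\<close> across a bond with letters \<open>x\<close>, \<open>y\<close>; \<open>l'\<close> is \<open>l\<close> with these exchanged.
  For the ring weight it is a difference of weights of shortened words, which telescopes around the
  ring.\<close>

definition flux :: "('a::linorder list \<Rightarrow> real) \<Rightarrow> 'a list \<Rightarrow> 'a list \<Rightarrow> 'a \<Rightarrow> 'a \<Rightarrow> real" where
  "flux f l l' x y = (if x < y then f l' else if y < x then - f l else 0)"

lemma flux_ring_weight:
  assumes "2 \<in> set (u @ x # y # v)" and "{x, y} \<subseteq> {1, 2, 3}"
  shows "flux (\<lambda>l. real (ring_weight l)) (u @ x # y # v) (u @ y # x # v) x y =
    letter_sign x * ring_weight (u @ y # v) - letter_sign y * ring_weight (u @ x # v)"
proof -
  consider "x = y" | "x = 1" "y = 2" | "x = 2" "y = 1" | "x = 1" "y = 3" | "x = 3" "y = 1"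
    | "x = 2" "y = 3" | "x = 3" "y = 2"
    using assms(2) by blast
  then show ?thesis
  proof cases
    case 4
    with assms(1) show ?thesis
      using ring_weight_31[of u v] by (simp add: flux_def letter_sign_def)
  next
    case 5
    with assms(1) show ?thesis
      using ring_weight_31[of u v] by (simp add: flux_def letter_sign_def)
  qed (use ring_weight_21[of u v] ring_weight_32[of u v]
      in \<open>simp_all add: flux_def letter_sign_def\<close>)
qed

section \<open>Stationary weights of exchange dynamics on a ring\<close>

lemma left_site_in: "k \<in> {1..n} \<Longrightarrow> left_site n k \<in> {1..n}"
  by (auto simp: left_site_def)

lemma bij_betw_left_site: "bij_betw (left_site n) {1..n} {1..n}"
proof (rule bij_betw_imageI)
  show inj: "inj_on (left_site n) {1..n}"
    by (auto simp: inj_on_def left_site_def split: if_splits)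
  show "left_site n ` {1..n} = {1..n}"
    by (rule endo_inj_surj) (use inj left_site_in in auto)
qed

definition ring_swap :: "nat \<Rightarrow> nat \<Rightarrow> 'a list \<Rightarrow> 'a list" where
  "ring_swap n k l = l[k - 1 := l ! (left_site n k - 1), left_site n k - 1 := l ! (k - 1)]"

definition ring_descent :: "nat \<Rightarrow> nat \<Rightarrow> 'a::linorder list \<Rightarrow> bool" where
  "ring_descent n k l \<longleftrightarrow> l ! (k - 1) < l ! (left_site n k - 1)"

lemma length_ring_swap [simp]: "length (ring_swap n k l) = length l"
  by (simp add: ring_swap_def)

lemma mset_ring_swap:
  assumes "k \<in> {1..n}" "length l = n"
  shows "mset (ring_swap n k l) = mset l"
  unfolding ring_swap_def using assms left_site_in[OF assms(1)]
  by (intro mset_swap) auto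

lemma nth_ring_swap:
  assumes "k \<in> {1..n}" "length l = n" "p \<in> {1..n}"
  shows "ring_swap n k l ! (p - 1) =
    (if p = left_site n k then l ! (k - 1) else if p = k then l ! (left_site n k - 1) else l ! (p - 1))"
  using assms left_site_in[OF assms(1)]
  by (auto simp: ring_swap_def nth_list_update)

lemma ring_swap_ring_swap:
  assumes "k \<in> {1..n}" "length l = n"
  shows "ring_swap n k (ring_swap n k l) = l"
proof -
  have "k - 1 < length l" "left_site n k - 1 < length l"
    using assms left_site_in[OF assms(1)] by auto
  then show ?thesis
    by (intro nth_equalityI) (auto simp: ring_swap_def nth_list_update)
qed

lemma ring_descent_ring_swap:
  assumes "k \<in> {1..n}" "length l = n" "n \<ge> 2"
  shows "ring_descent n k (ring_swap n k l) \<longleftrightarrow> l ! (left_site n k - 1) < l ! (k - 1)"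
proof -
  have "left_site n k \<noteq> k" using assms by (auto simp: left_site_def)
  then show ?thesis
    using nth_ring_swap[OF assms(1,2) assms(1)]
      nth_ring_swap[OF assms(1,2) left_site_in[OF assms(1)]]
    by (simp add: ring_descent_def)
qed

lemma ring_swap_split: "ring_swap (length u + length v + 2) (length u + 2) (u @ x # y # v) = u @ y # x # v"
  by (simp add: ring_swap_def left_site_def nth_append list_update_append)

lemma ring_descent_split:
  "ring_descent (length u + length v + 2) (length u + 2) (u @ x # y # v) \<longleftrightarrow> y < x"
  by (simp add: ring_descent_def left_site_def nth_append)

lemma ring_weight_balance:
  assumes "n \<ge> 2" "length l = n" "set l \<subseteq> {1, 2, 3}" "2 \<in> set l"
  shows "(\<Sum>k = 1..n. flux (\<lambda>l. real (ring_weight l)) l (ring_swap n k l)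
            (l ! (left_site n k - 1)) (l ! (k - 1))) = 0"
proof -
  \<comment> \<open>This is the signed weight of the ring with site \<open>k\<close> deleted. The
    flux across the bond at \<open>k\<close> is a difference of two such terms, so the sum around
    the ring telescopes.\<close>
  define D where "D k = letter_sign (l ! (k - 1)) * ring_weight (take (k - 1) l @ drop k l)" for k
  have "flux (\<lambda>l. real (ring_weight l)) l (ring_swap n k l) (l ! (left_site n k - 1)) (l ! (k - 1))
      = D (left_site n k) - D k" if k: "k \<in> {1..n}" for k
  proof (cases "k = 1")
    case False
    define u v x y where "u = take (k - 2) l" and "v = drop k l"
      and "x = l ! (k - 2)" and "y = l ! (k - 1)"
    have k2: "k \<ge> 2" "k \<le> n" using k False by auto
    have l: "l = u @ x # y # v"
    proof -
      obtain e where "k = Suc (Suc e)" using k2(1) by (metis add_2_eq_Suc le_Suc_ex)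
      then show ?thesis
        using k2(2) assms(2) id_take_nth_drop[of e l] Cons_nth_drop_Suc[of "Suc e" l]
        unfolding u_def v_def x_def y_def by simp
    qed
    have n: "n = length u + length v + 2" and ku: "k = length u + 2"
      using k2 assms(2) by (auto simp: u_def v_def)
    have "left_site n k = length u + 1" using ku by (simp add: left_site_def)
    then show ?thesis
      using flux_ring_weight[of u x y v] assms(3,4) ring_swap_split[of u v x y]
      by (simp add: l n ku D_def nth_append)
  next
    case True
    obtain y w where "l = y # w" using assms by (cases l) auto
    moreover from this assms obtain v x where "w = v @ [x]" by (cases w rule: rev_cases) auto
    ultimately have l: "l = y # v @ [x]" by simp
    have n: "n = length v + 2" using assms l by simp
    have swap: "ring_swap n k l = x # v @ [y]"
      by (simp add: ring_swap_def left_site_def True l n nth_append list_update_append)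
    have rot: "ring_weight (y # v @ [x]) = ring_weight (x # y # v)"
      "ring_weight (x # v @ [y]) = ring_weight (y # x # v)"
      using ring_weight_rotate[of "y # v" "[x]"] ring_weight_rotate[of "x # v" "[y]"] assms(4) l
      by auto
    \<comment> \<open>Rotation requires a remaining 2. If deleting \<open>y\<close> removes the only
      one, then \<open>y = 2\<close> and the sign is 0.\<close>
    have del: "letter_sign y * ring_weight (v @ [x]) = letter_sign y * ring_weight (x # v)"
      using ring_weight_rotate[of v "[x]"] assms(4) l by (auto simp: letter_sign_def)
    have "flux (\<lambda>l. real (ring_weight l)) (x # y # v) (y # x # v) x y =
      letter_sign x * ring_weight (y # v) - letter_sign y * ring_weight (x # v)"
      using flux_ring_weight[of "[]" x y v] assms(3,4) l by auto
    then have "flux (\<lambda>l. real (ring_weight l)) l (ring_swap n k l) x y =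
      letter_sign x * ring_weight (y # v) - letter_sign y * ring_weight (v @ [x])"
      unfolding swap del unfolding l flux_def rot .
    then show ?thesis
      by (simp add: True l n left_site_def D_def nth_append)
  qed
  then have "(\<Sum>k = 1..n. flux (\<lambda>l. real (ring_weight l)) l (ring_swap n k l)
            (l ! (left_site n k - 1)) (l ! (k - 1))) = (\<Sum>k = 1..n. D (left_site n k) - D k)"
    by (intro sum.cong) auto
  also have "\<dots> = 0"
    using sum.reindex_bij_betw[OF bij_betw_left_site[of n], of D] by (simp add: sum_subtractf)
  finally show ?thesis .
qed

section \<open>Weak form of stationarity, and uniqueness up to scaling\<close>

definition ring_stationary :: "nat \<Rightarrow> 'a::linorder list set \<Rightarrow> ('a list \<Rightarrow> real) \<Rightarrow> bool" where
  "ring_stationary n W f \<longleftrightarrow>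
     (\<forall>F. (\<Sum>l\<in>W. \<Sum>k = 1..n. of_bool (ring_descent n k l) * f l * (F (ring_swap n k l) - F l)) = 0)"

text \<open>Summation by parts: \<open>ring_swap n k\<close> is an involution of the words, so it
  can be moved from \<open>F\<close> to \<open>f\<close>. The coefficient of \<open>F l\<close> is
  then the net gain of \<open>l\<close>, which \<open>bal\<close> makes zero.\<close>

lemma ring_stationaryI:
  assumes n: "n \<ge> 2" "size M = n"
    and bal: "\<And>l. l \<in> permutations_of_multiset M \<Longrightarrow>
      (\<Sum>k = 1..n. flux f l (ring_swap n k l) (l ! (left_site n k - 1)) (l ! (k - 1))) = 0"
  shows "ring_stationary n (permutations_of_multiset M) f"
  unfolding ring_stationary_def
proof
  fix F :: "'a list \<Rightarrow> real"
  have len: "length l = n" if "l \<in> permutations_of_multiset M" for l using that n by (auto simp: permutations_of_multiset_def)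
  have swap_in: "ring_swap n k l \<in> permutations_of_multiset M" if "k \<in> {1..n}" "l \<in> permutations_of_multiset M" for k l
    using that len[OF that(2)] mset_ring_swap[of k n l] by (simp add: permutations_of_multiset_def)
  have desc: "ring_swap n k l ! (left_site n k - 1) < ring_swap n k l ! (k - 1) \<longleftrightarrow>
      ring_descent n k l" if "k \<in> {1..n}" "l \<in> permutations_of_multiset M" for k l
    using ring_descent_ring_swap[OF that(1), of "ring_swap n k l"] len that n(1)
    by (simp add: ring_swap_ring_swap)
  have reindex: "(\<Sum>l\<in>permutations_of_multiset M. of_bool (ring_descent n k l) * f l * F (ring_swap n k l)) =
      (\<Sum>l\<in>permutations_of_multiset M. of_bool (l ! (left_site n k - 1) < l ! (k - 1)) * f (ring_swap n k l) * F l)"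
    if k: "k \<in> {1..n}" for k
    by (rule sum.reindex_bij_witness[of _ "ring_swap n k" "ring_swap n k"])
      (use k n(1) desc[OF k] in \<open>simp_all add: len swap_in ring_swap_ring_swap\<close>)
  have "(\<Sum>l\<in>permutations_of_multiset M. \<Sum>k = 1..n. of_bool (ring_descent n k l) * f l * (F (ring_swap n k l) - F l)) =
      (\<Sum>k = 1..n. \<Sum>l\<in>permutations_of_multiset M. of_bool (ring_descent n k l) * f l * F (ring_swap n k l)) -
      (\<Sum>l\<in>permutations_of_multiset M. \<Sum>k = 1..n. of_bool (ring_descent n k l) * f l * F l)"
    by (simp add: algebra_simps sum_subtractf sum.swap[of _ "permutations_of_multiset M"])
  also have "(\<Sum>k = 1..n. \<Sum>l\<in>permutations_of_multiset M. of_bool (ring_descent n k l) * f l * F (ring_swap n k l)) =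
     (\<Sum>l\<in>permutations_of_multiset M. \<Sum>k = 1..n.
        of_bool (l ! (left_site n k - 1) < l ! (k - 1)) * f (ring_swap n k l) * F l)"
    by (subst sum.swap) (intro sum.cong refl reindex)
  also have "\<dots> - (\<Sum>l\<in>permutations_of_multiset M. \<Sum>k = 1..n. of_bool (ring_descent n k l) * f l * F l) =
     (\<Sum>l\<in>permutations_of_multiset M. (\<Sum>k = 1..n. flux f l (ring_swap n k l) (l ! (left_site n k - 1)) (l ! (k - 1))) * F l)"
    unfolding sum_subtractf[symmetric] sum_distrib_right
    by (intro sum.cong refl) (auto simp: flux_def ring_descent_def)
  also have "\<dots> = 0" using bal by simp
  finally show "(\<Sum>l\<in>permutations_of_multiset M. \<Sum>k = 1..n.
      of_bool (ring_descent n k l) * f l * (F (ring_swap n k l) - F l)) = 0" .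
qed

text \<open>Adjacent exchanges connect all words with the same letters: the first letter of
  \<open>l\<close> is moved step by step to the front of \<open>l'\<close>, and induction treats the
  rest.\<close>

lemma adjacent_swap_invariant:
  assumes "\<And>u x y v. mset (u @ x # y # v) = M \<Longrightarrow> g (u @ x # y # v) = g (u @ y # x # v)"
    and "mset l = M" "mset l' = M"
  shows "g l = g l'"
proof -
  have front: "g (u @ a @ x # b) = g (u @ x # a @ b)" if "mset (u @ a @ x # b) = M" for u a x b
    using that
  proof (induction a arbitrary: b rule: rev_induct)
    case (snoc y a)
    have "g (u @ (a @ [y]) @ x # b) = g (u @ a @ x # y # b)"
      using assms(1)[of "u @ a" y x b] snoc.prems by (simp add: add_mset_commute)
    also have "\<dots> = g (u @ x # a @ y # b)"
      using snoc.prems by (intro snoc.IH) (simp add: add_mset_commute)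
    finally show ?case by simp
  qed simp
  have "g (u @ l) = g (u @ l')" if "mset l = mset l'" "mset (u @ l) = M" for u l l'
    using that
  proof (induction l arbitrary: u l')
    case (Cons x l)
    then have "x \<in> set l'" by (metis list.set_intros(1) mset_eq_setD)
    then obtain a b where l': "l' = a @ x # b" by (meson split_list)
    have "g (u @ x # l) = g ((u @ [x]) @ a @ b)"
      using Cons.prems l' Cons.IH[of "a @ b" "u @ [x]"] by simp
    also have "\<dots> = g (u @ l')" using front[of u a x b] Cons.prems l' by simp
    finally show ?case .
  qed simp
  from this[of l l' "[]"] show ?thesis using assms by simp
qed

text \<open>The Dirichlet form of the quotient \<open>g = f / h\<close> vanishes, so \<open>g\<close> is unchanged by every
  exchange, in whichever direction the dynamics allows it.\<close>

lemma ring_stationary_unique: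
  assumes n: "n \<ge> 2" "size M = n"
    and f: "ring_stationary n (permutations_of_multiset M) f" and h: "ring_stationary n (permutations_of_multiset M) h"
    and pos: "\<And>l. l \<in> permutations_of_multiset M \<Longrightarrow> h l > 0"
    and l: "l \<in> permutations_of_multiset M" "l' \<in> permutations_of_multiset M"
  shows "f l * h l' = f l' * h l"
proof -
  define g where "g l = f l / h l" for l
  have f_eq: "f l = h l * g l" if "l \<in> permutations_of_multiset M" for l
    using pos[OF that] by (simp add: g_def)
  define E where "E l k = of_bool (ring_descent n k l) * h l * (g l - g (ring_swap n k l))\<^sup>2" for l k
  \<comment> \<open>Writing g' for the value after the exchange, (g - g')^2 = g'^2 - g^2 - 2 g (g' -
    g), and h g = f. The first part is stationarity of \<open>h\<close> tested on the square of
    \<open>g\<close>, the second is stationarity of \<open>f\<close> tested on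
    \<open>g\<close>.\<close>
  have "E l k = of_bool (ring_descent n k l) * h l * ((g (ring_swap n k l))\<^sup>2 - (g l)\<^sup>2)
      - 2 * (of_bool (ring_descent n k l) * f l * (g (ring_swap n k l) - g l))"
    if "l \<in> permutations_of_multiset M" for l k
    by (simp add: E_def f_eq[OF that] power2_eq_square algebra_simps)
  then have "(\<Sum>l\<in>permutations_of_multiset M. \<Sum>k = 1..n. E l k) =
     (\<Sum>l\<in>permutations_of_multiset M. \<Sum>k = 1..n. of_bool (ring_descent n k l) * h l * ((g (ring_swap n k l))\<^sup>2 - (g l)\<^sup>2))
     - 2 * (\<Sum>l\<in>permutations_of_multiset M. \<Sum>k = 1..n. of_bool (ring_descent n k l) * f l * (g (ring_swap n k l) - g l))"
    by (simp add: sum_subtractf sum_distrib_left)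
  also have "\<dots> = 0"
    using h[unfolded ring_stationary_def, rule_format, of "\<lambda>l. (g l)\<^sup>2"]
      f[unfolded ring_stationary_def, rule_format, of g] by simp
  finally have sum0: "(\<Sum>l\<in>permutations_of_multiset M. \<Sum>k = 1..n. E l k) = 0" .
  have E_nonneg: "E l k \<ge> 0" if "l \<in> permutations_of_multiset M" for l k
    using pos[OF that] by (simp add: E_def)
  have E0: "E l k = 0" if "l \<in> permutations_of_multiset M" "k \<in> {1..n}" for l k
  proof -
    have "(\<Sum>k = 1..n. E l k) = 0"
      using sum0 that E_nonneg by (subst (asm) sum_nonneg_eq_0_iff) (auto intro!: sum_nonneg finite_permutations_of_multiset)
    then show ?thesis
      using that E_nonneg by (subst (asm) sum_nonneg_eq_0_iff) auto
  qed
  have desc: "g (u @ x # y # v) = g (u @ y # x # v)"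
    if "mset (u @ x # y # v) = M" "y < x" for u x y v
  proof -
    have "n = length u + length v + 2"
      using that n by (metis add_2_eq_Suc' add_Suc_right length_Cons length_append size_mset)
    then show ?thesis
      using E0[of "u @ x # y # v" "length u + 2"] that pos[of "u @ x # y # v"]
        ring_swap_split[of u v x y] ring_descent_split[of u v x y]
      by (simp add: E_def permutations_of_multiset_def)
  qed
  have "g l = g l'"
  proof (rule adjacent_swap_invariant[of M])
    fix u x y v assume M: "mset (u @ x # y # v) = M"
    then have M': "mset (u @ y # x # v) = M" by (simp add: add_mset_commute)
    \<comment> \<open>\<open>E\<close> sees descents only, but of two distinct adjacent letters one
      of the two orders is a descent.\<close>
    show "g (u @ x # y # v) = g (u @ y # x # v)"
      using desc[OF M] desc[OF M'] by (cases x y rule: linorder_cases) auto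
  qed (use l in \<open>auto simp: permutations_of_multiset_def\<close>)
  then show ?thesis
    using pos[OF l(1)] pos[OF l(2)] by (simp add: g_def field_simps)
qed

section \<open>Lumping species into three classes\<close>

lemma swap_left_conv_transpose: "swap_left n k w = w \<circ> Transposition.transpose k (left_site n k)"
  by (auto simp: swap_left_def transpose_def fun_eq_iff)

lemma swap_left_in_tasep_states:
  assumes "k \<in> {1..n}" "w \<in> tasep_states n"
  shows "swap_left n k w \<in> tasep_states n"
  using assms left_site_in[OF assms(1)]
  by (auto simp: swap_left_conv_transpose tasep_states_def intro!: permutes_compose permutes_swap_id)

lemma finite_tasep_states: "finite (tasep_states n)"
  by (simp add: tasep_states_def finite_permutations)

text \<open>The rows of the generator sum to zero, so it acts on \<open>F\<close> through
  differences, and its rates split into one possible exchange per ringing site.\<close>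

lemma tasep_stationary_test_function:
  assumes st: "tasep_stationary n \<pi>"
  shows "(\<Sum>w\<in>tasep_states n. pmf \<pi> w *
    (\<Sum>k = 1..n. of_bool (w k < w (left_site n k)) * (F (swap_left n k w) - F w))) = 0"
proof -
  let ?S = "tasep_states n"
  have rate: "tasep_rate n w v =
      (\<Sum>k = 1..n. of_bool (w k < w (left_site n k) \<and> v = swap_left n k w))" for w v
    by (simp add: tasep_rate_def sum_of_bool_eq Int_def)
  have gen: "(\<Sum>v\<in>?S. tasep_generator n w v * F v) =
      (\<Sum>k = 1..n. of_bool (w k < w (left_site n k)) * (F (swap_left n k w) - F w))"
    if w: "w \<in> ?S" for w
  proof -
    have "(\<Sum>v\<in>?S. tasep_generator n w v * F v) =
        tasep_generator n w w * F w + (\<Sum>v\<in>?S - {w}. tasep_generator n w v * F v)"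
      using w by (intro sum.remove finite_tasep_states)
    also have "(\<Sum>v\<in>?S - {w}. tasep_generator n w v * F v) = (\<Sum>v\<in>?S - {w}. tasep_rate n w v * F v)"
      by (intro sum.cong) (auto simp: tasep_generator_def)
    also have "tasep_generator n w w * F w + \<dots> = (\<Sum>v\<in>?S - {w}. tasep_rate n w v * (F v - F w))"
      by (simp add: tasep_generator_def sum_distrib_right sum_subtractf right_diff_distrib)
    \<comment> \<open>The state \<open>w\<close> can be put back because \<open>F v - F w\<close>
      vanishes at \<open>v = w\<close>.\<close>
    also have "\<dots> = (\<Sum>v\<in>?S. tasep_rate n w v * (F v - F w))"
      using w by (subst (2) sum.remove[of _ w]) (auto simp: finite_tasep_states)
    also have "\<dots> = (\<Sum>k = 1..n. \<Sum>v\<in>?S.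
        of_bool (w k < w (left_site n k) \<and> v = swap_left n k w) * (F v - F w))"
      unfolding rate sum_distrib_right by (rule sum.swap)
    also have "\<dots> = (\<Sum>k = 1..n. of_bool (w k < w (left_site n k)) * (F (swap_left n k w) - F w))"
    proof (rule sum.cong[OF refl])
      fix k assume k: "k \<in> {1..n}"
      have "(\<Sum>v\<in>?S. of_bool (w k < w (left_site n k) \<and> v = swap_left n k w) * (F v - F w)) =
        (\<Sum>v\<in>?S. if v = swap_left n k w then of_bool (w k < w (left_site n k)) * (F v - F w) else 0)"
        by (intro sum.cong) auto
      then show "(\<Sum>v\<in>?S. of_bool (w k < w (left_site n k) \<and> v = swap_left n k w) * (F v - F w)) =
          of_bool (w k < w (left_site n k)) * (F (swap_left n k w) - F w)"
        using swap_left_in_tasep_states[OF k w] by (simp add: finite_tasep_states)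
    qed
    finally show ?thesis .
  qed
  have "(\<Sum>w\<in>?S. pmf \<pi> w * (\<Sum>v\<in>?S. tasep_generator n w v * F v)) =
      (\<Sum>v\<in>?S. (\<Sum>w\<in>?S. pmf \<pi> w * tasep_generator n w v) * F v)"
    unfolding sum_distrib_left sum_distrib_right by (subst sum.swap) (simp add: mult.assoc)
  also have "\<dots> = 0"
    using st by (simp add: tasep_stationary_def)
  finally show ?thesis using gen by simp
qed

section \<open>Class words and lumpability\<close>

definition species_class :: "nat \<Rightarrow> nat \<Rightarrow> nat \<Rightarrow> nat" where
  "species_class s t x = (if x \<le> s then 1 else if x \<le> t then 2 else 3)"

definition class_word :: "nat \<Rightarrow> nat \<Rightarrow> nat \<Rightarrow> (nat \<Rightarrow> nat) \<Rightarrow> nat list" where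
  "class_word n s t w = map (\<lambda>p. species_class s t (w p)) [1..<Suc n]"

definition class_content :: "nat \<Rightarrow> nat \<Rightarrow> nat \<Rightarrow> nat multiset" where
  "class_content s d r = replicate_mset s 1 + replicate_mset d 2 + replicate_mset r 3"

lemma length_class_word [simp]: "length (class_word n s t w) = n"
  by (simp add: class_word_def)

lemma nth_class_word: "p \<in> {1..n} \<Longrightarrow> class_word n s t w ! (p - 1) = species_class s t (w p)"
  by (auto simp: class_word_def nth_append simp del: upt_Suc)

lemma mset_class_word:
  assumes "w \<in> tasep_states n" "s \<le> t" "t \<le> n"
  shows "mset (class_word n s t w) = class_content s (t - s) (n - t)"
proof -
  have w: "w permutes {1..n}" using assms by (simp add: tasep_states_def)
  have "mset (map w [1..<Suc n]) = mset [1..<Suc n]"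
  proof (rule set_eq_iff_mset_eq_distinct[THEN iffD1])
    show "distinct (map w [1..<Suc n])"
      using permutes_inj[OF w] by (simp add: distinct_map inj_on_def inj_def del: upt_Suc)
    show "set (map w [1..<Suc n]) = set [1..<Suc n]"
      using permutes_image[OF w] by (simp add: atLeastLessThanSuc_atLeastAtMost del: upt_Suc)
  qed simp
  then have "mset (map (species_class s t) (map w [1..<Suc n])) =
      mset (map (species_class s t) [1..<Suc n])"
    by (simp only: mset_map)
  moreover have "class_word n s t w = map (species_class s t) (map w [1..<Suc n])"
    by (simp add: class_word_def del: upt_Suc)
  moreover have "[1..<Suc n] = [1..<Suc s] @ [Suc s..<Suc t] @ [Suc t..<Suc n]"
    using upt_add_eq_append[of 1 "Suc s" "n - s"] upt_add_eq_append[of "Suc s" "Suc t" "n - t"] assms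
    by (simp del: upt_Suc)
  moreover have "map (species_class s t) [1..<Suc s] = replicate s 1"
    "map (species_class s t) [Suc s..<Suc t] = replicate (t - s) 2"
    "map (species_class s t) [Suc t..<Suc n] = replicate (n - t) 3"
    using assms by (auto intro!: nth_equalityI simp: species_class_def simp del: upt_Suc)
  ultimately show ?thesis
    by (simp only: map_append mset_append mset_replicate class_content_def add.assoc)
qed

lemma class_word_swap_left:
  assumes "k \<in> {1..n}"
  shows "class_word n s t (swap_left n k w) = ring_swap n k (class_word n s t w)"
proof (rule nth_equalityI)
  fix p assume "p < length (class_word n s t (swap_left n k w))"
  then have p: "Suc p \<in> {1..n}" by simp
  show "class_word n s t (swap_left n k w) ! p = ring_swap n k (class_word n s t w) ! p"
    using nth_class_word[OF p, of s t "swap_left n k w"] nth_class_word[OF p, of s t w]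
      nth_class_word[OF assms, of s t w] nth_class_word[OF left_site_in[OF assms], of s t w]
      nth_ring_swap[OF assms _ p, of "class_word n s t w"]
    by (simp add: swap_left_def)
qed simp

lemma ring_descent_class_word:
  assumes "k \<in> {1..n}"
  shows "ring_descent n k (class_word n s t w) \<longleftrightarrow>
    species_class s t (w k) < species_class s t (w (left_site n k))"
  using nth_class_word[OF assms, of s t w] nth_class_word[OF left_site_in[OF assms], of s t w]
  by (simp add: ring_descent_def)

lemma ring_swap_trivial:
  assumes "l ! (left_site n k - 1) = l ! (k - 1)"
  shows "ring_swap n k l = l"
  using assms by (metis list_update_id ring_swap_def)

text \<open>An exchange inside one class leaves the word unchanged, and between distinct classes the
  order of the species is the order of the classes. Test functions of the class word therefore see
  exchange dynamics of the same kind.\<close>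

lemma ring_stationary_class_word:
  assumes st: "tasep_stationary n \<pi>" and "s \<le> t" "t \<le> n"
  shows "ring_stationary n (permutations_of_multiset (class_content s (t - s) (n - t)))
    (\<lambda>l. \<Sum>w | w \<in> tasep_states n \<and> class_word n s t w = l. pmf \<pi> w)"
  unfolding ring_stationary_def
proof
  fix F :: "nat list \<Rightarrow> real"
  let ?S = "tasep_states n" and ?c = "class_word n s t"
    and ?W = "permutations_of_multiset (class_content s (t - s) (n - t))"
  define G where "G l = (\<Sum>k = 1..n. of_bool (ring_descent n k l) * (F (ring_swap n k l) - F l))" for l
  have eq: "of_bool (w k < w (left_site n k)) * (F (?c (swap_left n k w)) - F (?c w)) =
      of_bool (ring_descent n k (?c w)) * (F (ring_swap n k (?c w)) - F (?c w))"
    if k: "k \<in> {1..n}" for w k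
  proof (cases "species_class s t (w k) = species_class s t (w (left_site n k))")
    case True
    then have "ring_swap n k (?c w) = ?c w"
      using nth_class_word[OF k, of s t w] nth_class_word[OF left_site_in[OF k], of s t w]
      by (intro ring_swap_trivial) simp
    then show ?thesis by (simp add: class_word_swap_left[OF k])
  next
    case False
    then have "w k < w (left_site n k) \<longleftrightarrow> ring_descent n k (?c w)"
      unfolding ring_descent_class_word[OF k] by (auto simp: species_class_def split: if_splits)
    then show ?thesis by (simp add: class_word_swap_left[OF k])
  qed
  have "(\<Sum>l\<in>?W. \<Sum>k = 1..n. of_bool (ring_descent n k l) *
      (\<Sum>w | w \<in> ?S \<and> ?c w = l. pmf \<pi> w) * (F (ring_swap n k l) - F l)) =
      (\<Sum>l\<in>?W. \<Sum>w | w \<in> ?S \<and> ?c w = l. pmf \<pi> w * G (?c w))"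
  proof (rule sum.cong[OF refl])
    fix l
    let ?m = "\<Sum>w | w \<in> ?S \<and> ?c w = l. pmf \<pi> w"
    have "(\<Sum>k = 1..n. of_bool (ring_descent n k l) * m * (F (ring_swap n k l) - F l)) = m * G l" for m
      unfolding G_def sum_distrib_left by (simp only: mult_ac)
    then have "(\<Sum>k = 1..n. of_bool (ring_descent n k l) * ?m * (F (ring_swap n k l) - F l)) = ?m * G l" .
    also have "?m * G l = (\<Sum>w | w \<in> ?S \<and> ?c w = l. pmf \<pi> w * G (?c w))"
      by (simp add: sum_distrib_right)
    finally show "(\<Sum>k = 1..n. of_bool (ring_descent n k l) * ?m * (F (ring_swap n k l) - F l)) = \<dots>" .
  qed
  also have "\<dots> = (\<Sum>w\<in>?S. pmf \<pi> w * G (?c w))"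
    by (rule sum.group)
      (use assms mset_class_word in \<open>auto simp: finite_tasep_states intro!: permutations_of_multisetI\<close>)
  also have "\<dots> = 0"
    using tasep_stationary_test_function[OF st, of "\<lambda>w. F (?c w)"]
    by (simp add: G_def eq)
  finally show "(\<Sum>l\<in>?W. \<Sum>k = 1..n. of_bool (ring_descent n k l) *
      (\<Sum>w | w \<in> ?S \<and> ?c w = l. pmf \<pi> w) * (F (ring_swap n k l) - F l)) = 0" .
qed

section \<open>Counting queue histories\<close>

text \<open>A queue history is a list of pairs (arrival, service), one for each time step.\<close>

abbreviation arrivals :: "(bool \<times> bool) list \<Rightarrow> nat" where
  "arrivals xs \<equiv> length (filter fst xs)"

abbreviation services :: "(bool \<times> bool) list \<Rightarrow> nat" where
  "services xs \<equiv> length (filter snd xs)"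

text \<open>Truncated subtraction models a service that finds nobody: an empty queue stays empty. An
  arrival may be served within its own step.\<close>

primrec queue_run :: "nat \<Rightarrow> (bool \<times> bool) list \<Rightarrow> nat" where
  "queue_run q [] = q"
| "queue_run q (x # xs) = queue_run (q + of_bool (fst x) - of_bool (snd x)) xs"

primrec queue_letters :: "nat \<Rightarrow> (bool \<times> bool) list \<Rightarrow> nat list" where
  "queue_letters q [] = []"
| "queue_letters q (x # xs) =
     (if \<not> snd x then 3 else if q + of_bool (fst x) = 0 then 2 else 1) #
     queue_letters (q + of_bool (fst x) - of_bool (snd x)) xs"

lemma length_queue_letters [simp]: "length (queue_letters q xs) = length xs"
  by (induction xs arbitrary: q) auto

lemma finite_lists_length: "finite {xs :: 'a::finite list. length xs = m \<and> P xs}"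
  using finite_lists_length_eq[of "UNIV :: 'a set" m] by (rule rev_finite_subset) auto

lemma card_lists_Suc:
  "card {xs :: 'a::finite list. length xs = Suc m \<and> P xs} =
    (\<Sum>y\<in>UNIV. card {xs. length xs = m \<and> P (y # xs)})"
proof -
  have "{xs. length xs = Suc m \<and> P xs} = (\<Union>y. (#) y ` {xs. length xs = m \<and> P (y # xs)})"
    by (auto simp: length_Suc_conv image_iff)
  also have "card \<dots> = (\<Sum>y\<in>UNIV. card ((#) y ` {xs. length xs = m \<and> P (y # xs)}))"
    by (intro card_UN_disjoint) (auto intro!: finite_imageI finite_lists_length)
  finally show ?thesis by (simp add: card_image)
qed

lemma sum_UNIV_bool_pair:
  "(\<Sum>y\<in>UNIV. f y) = f (False, False) + f (False, True) + f (True, False) + f (True, True)"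
  for f :: "bool \<times> bool \<Rightarrow> 'a::comm_monoid_add"
  unfolding UNIV_Times_UNIV[symmetric] sum.cartesian_product'[symmetric]
  by (simp add: UNIV_bool add_ac)

text \<open>The word already fixes the services; splitting off the first pair of a history
  reproduces the recursion of \<open>queue_count\<close>.\<close>

lemma queue_count_eq_card:
  assumes "set u \<subseteq> {1, 2, 3}"
  shows "queue_count u q =
    card {xs. length xs = length u \<and> queue_letters q xs = u \<and> queue_run q xs = 0}"
  using assms
proof (induction u arbitrary: q)
  case Nil
  have "{xs. length xs = length [] \<and> queue_letters q xs = [] \<and> queue_run q xs = 0} =
      (if q = 0 then {[]} else {})" by auto
  then show ?case by simp
next
  case (Cons x u)
  then have IH: "card {xs. length xs = length u \<and> queue_letters q xs = u \<and> queue_run q xs = 0} =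
      queue_count u q" for q
    by simp
  show ?case
    using Cons.prems
    by (auto simp: card_lists_Suc sum_UNIV_bool_pair IH)
qed

lemma queue_letters_nth_3:
  "i < length xs \<Longrightarrow> queue_letters q xs ! i = 3 \<longleftrightarrow> \<not> snd (xs ! i)"
  by (induction xs arbitrary: q i) (auto simp: nth_Cons split: nat.split)

lemma count_queue_letters_3: "count (mset (queue_letters q xs)) 3 + services xs = length xs"
  by (induction xs arbitrary: q) auto

lemma count_queue_letters_1_2:
  "count (mset (queue_letters q xs)) 1 + count (mset (queue_letters q xs)) 2 = services xs"
  by (induction xs arbitrary: q) auto

lemma count_queue_letters_1:
  "count (mset (queue_letters q xs)) 1 + queue_run q xs = q + arrivals xs"
proof (induction xs arbitrary: q)
  case (Cons x xs)
  show ?case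
    using Cons.IH[of "q + of_bool (fst x) - of_bool (snd x)"]
    by (cases q; cases "fst x"; cases "snd x") simp_all
qed simp

lemma set_queue_letters: "set (queue_letters q xs) \<subseteq> {1, 2, 3}"
  by (induction xs arbitrary: q) auto

text \<open>A queue that starts and ends empty serves every arrival, so the letters 1 count
  arrivals. The letters 1 and 2 together count services, and 3 fills the remaining steps.\<close>

lemma mset_queue_letters_eq_class_content:
  assumes "queue_run 0 xs = 0"
  shows "mset (queue_letters 0 xs) = class_content s d r \<longleftrightarrow>
    arrivals xs = s \<and> services xs = s + d \<and> length xs = s + d + r"
proof -
  note eqs = count_queue_letters_3[of 0 xs] count_queue_letters_1_2[of 0 xs]
    count_queue_letters_1[of 0 xs]
  show ?thesis
  proof
    assume "mset (queue_letters 0 xs) = class_content s d r"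
    then show "arrivals xs = s \<and> services xs = s + d \<and> length xs = s + d + r"
      using eqs assms by (simp add: class_content_def)
  next
    assume a: "arrivals xs = s \<and> services xs = s + d \<and> length xs = s + d + r"
    show "mset (queue_letters 0 xs) = class_content s d r"
    proof (rule multiset_eqI)
      fix c
      show "count (mset (queue_letters 0 xs)) c = count (class_content s d r) c"
        using eqs a assms set_queue_letters[of 0 xs]
        by (cases "c \<in> {1, 2, 3}") (auto simp: class_content_def count_mset_0_iff)
    qed
  qed
qed

lemma sum_queue_count:
  "(\<Sum>u\<in>{u \<in> permutations_of_multiset (class_content s d r). Q u}. queue_count u 0) =
    card {xs. length xs = s + d + r \<and> queue_run 0 xs = 0 \<and> arrivals xs = s \<and> services xs = s + d \<and>
      Q (queue_letters 0 xs)}"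
  (is "_ = card ?A")
proof -
  let ?U = "{u \<in> permutations_of_multiset (class_content s d r). Q u}"
  have "queue_count u 0 = (\<Sum>xs | xs \<in> ?A \<and> queue_letters 0 xs = u. 1)" if u: "u \<in> ?U" for u
  proof -
    have m: "mset u = class_content s d r" using u by (simp add: permutations_of_multiset_def)
    have "set_mset (mset u) \<subseteq> {1, 2, 3}"
      unfolding m by (auto simp: class_content_def split: if_splits)
    moreover have "size (mset u) = s + d + r" unfolding m by (simp add: class_content_def)
    ultimately have "queue_count u 0 =
        card {xs. length xs = s + d + r \<and> queue_letters 0 xs = u \<and> queue_run 0 xs = 0}"
      using queue_count_eq_card[of u 0] by simp
    also have "{xs. length xs = s + d + r \<and> queue_letters 0 xs = u \<and> queue_run 0 xs = 0} =
        {xs \<in> ?A. queue_letters 0 xs = u}"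
      using mset_queue_letters_eq_class_content[of _ s d r] m u by auto
    finally show ?thesis by simp
  qed
  then have "(\<Sum>u\<in>?U. queue_count u 0) = (\<Sum>u\<in>?U. \<Sum>xs | xs \<in> ?A \<and> queue_letters 0 xs = u. 1)"
    by (intro sum.cong) auto
  also have "\<dots> = (\<Sum>xs\<in>?A. 1)"
    using mset_queue_letters_eq_class_content[of _ s d r]
    by (intro sum.group) (auto simp: finite_lists_length intro!: permutations_of_multisetI)
  finally show ?thesis by simp
qed

section \<open>Queue histories read backwards\<close>

lemma queue_run_append: "queue_run q (xs @ ys) = queue_run (queue_run q xs) ys"
  by (induction xs arbitrary: q) auto

text \<open>The final queue length is the largest excess of arrivals over services in a final
  segment of the history. The general bound \<open>d\<close> is what the induction on the last step
  needs, since that step shifts the bound.\<close>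

lemma queue_run_rev_le:
  "queue_run 0 (rev ys) \<le> d \<longleftrightarrow> (\<forall>k. arrivals (take k ys) \<le> d + services (take k ys))"
proof (induction ys arbitrary: d)
  case (Cons x ys)
  have "queue_run 0 (rev (x # ys)) \<le> d \<longleftrightarrow> of_bool (fst x) \<le> d + of_bool (snd x) \<and>
      queue_run 0 (rev ys) \<le> d + of_bool (snd x) - of_bool (fst x)"
    by (auto simp: queue_run_append)
  also have "\<dots> \<longleftrightarrow> (\<forall>k. of_bool (fst x) + arrivals (take k ys) \<le> d + of_bool (snd x) + services (take k ys))"
    (is "?L \<longleftrightarrow> ?R")
  proof
    assume R: ?R
    then have "of_bool (fst x) \<le> d + of_bool (snd x)" by (metis add_0_right filter.simps(1) list.size(3) take_0)
    moreover have "arrivals (take k ys) \<le> d + of_bool (snd x) - of_bool (fst x) + services (take k ys)" for k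
      using R[rule_format, of k] calculation by auto
    ultimately show ?L unfolding Cons.IH by blast
  next
    assume L: ?L
    show ?R
    proof
      fix k
      have "arrivals (take k ys) \<le> d + of_bool (snd x) - of_bool (fst x) + services (take k ys)"
        using L Cons.IH by blast
      with L show "of_bool (fst x) + arrivals (take k ys) \<le>
          d + of_bool (snd x) + services (take k ys)"
        by linarith
    qed
  qed
  also have "\<dots> \<longleftrightarrow> (\<forall>k. arrivals (take (Suc k) (x # ys)) \<le> d + services (take (Suc k) (x # ys)))"
    by (auto simp: of_bool_def)
  also have "\<dots> \<longleftrightarrow> (\<forall>k. arrivals (take k (x # ys)) \<le> d + services (take k (x # ys)))"
    by (metis filter.simps(1) le0 list.size(3) not0_implies_Suc take_0)
  finally show ?case .
qed simp

lemma queue_run_rev_eq_0: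
  "queue_run 0 (rev ys) = 0 \<longleftrightarrow> (\<forall>k. arrivals (take k ys) \<le> services (take k ys))"
  using queue_run_rev_le[of ys 0] by simp

text \<open>In the backward criterion a new first step adds one condition, on the history as a
  whole. This permits a recursion on histories that always start from the empty queue.\<close>

lemma queue_run_Cons_eq_0:
  "queue_run 0 (x # xs) = 0 \<longleftrightarrow>
     queue_run 0 xs = 0 \<and> arrivals (x # xs) \<le> services (x # xs)"
proof -
  have "queue_run 0 (x # xs) = 0 \<longleftrightarrow>
      (\<forall>k. arrivals (take k (rev xs @ [x])) \<le> services (take k (rev xs @ [x])))"
    using queue_run_rev_eq_0[of "rev xs @ [x]"] by simp
  also have "\<dots> \<longleftrightarrow> (\<forall>k. arrivals (take k (rev xs)) \<le> services (take k (rev xs))) \<and>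
      arrivals (rev xs @ [x]) \<le> services (rev xs @ [x])" (is "?L \<longleftrightarrow> ?R")
  proof
    assume L: ?L
    have "arrivals (take k (rev xs)) \<le> services (take k (rev xs))" for k
      using L[rule_format, of "min k (length xs)"] by (simp add: min_def split: if_splits)
    with L[rule_format, of "Suc (length xs)"] show ?R by simp
  next
    assume ?R
    then show ?L by (auto simp: take_append take_Cons' split: if_splits)
  qed
  also have "(\<forall>k. arrivals (take k (rev xs)) \<le> services (take k (rev xs))) \<longleftrightarrow> queue_run 0 xs = 0"
    using queue_run_rev_eq_0[of "rev xs"] by simp
  finally show ?thesis by (simp add: rev_filter flip: rev_filter)
qed

section \<open>A ballot-type count of histories\<close>

definition queue_paths :: "nat \<Rightarrow> nat \<Rightarrow> nat \<Rightarrow> (bool \<times> bool) list set" where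
  "queue_paths m s b =
    {xs. length xs = m \<and> queue_run 0 xs = 0 \<and> arrivals xs = s \<and> services xs = b}"

text \<open>The first pair has four possible values; \<open>s \<le> b\<close> is exactly the extra
  condition of \<open>queue_run_Cons_eq_0\<close>.\<close>

lemma card_queue_paths_Suc:
  assumes "s \<le> b"
  shows "card (queue_paths (Suc m) s b) = card (queue_paths m s b)
    + (if b = 0 then 0 else card (queue_paths m s (b - 1)))
    + (if s = 0 then 0 else card (queue_paths m (s - 1) b))
    + (if s = 0 \<or> b = 0 then 0 else card (queue_paths m (s - 1) (b - 1)))"
  using assms
  by (cases s; cases b)
    (auto simp: queue_paths_def card_lists_Suc sum_UNIV_bool_pair queue_run_Cons_eq_0
      simp del: queue_run.simps intro!: arg_cong2[of _ _ _ _ "(+)"] arg_cong[of _ _ card])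

text \<open>The formula is a 2 x 2 determinant of reflection type, obtained from the recursion by
  Pascal's rule. The range includes \<open>s = Suc b\<close> because the recursion at
  \<open>s = b\<close> calls the pair \<open>s\<close>, \<open>b - 1\<close>.\<close>

lemma card_queue_paths:
  assumes "s \<le> Suc b"
  shows "int (card (queue_paths m s b)) =
    int (m choose s) * int (m choose b) -
    (if s = 0 then 0 else int (m choose (s - 1)) * int (m choose Suc b))"
  using assms
proof (induction m arbitrary: s b)
  case 0
  have "queue_paths 0 s b = (if s = 0 \<and> b = 0 then {[]} else {})"
    by (auto simp: queue_paths_def)
  then show ?case by (cases s; cases b) auto
next
  case (Suc m)
  show ?case
  proof (cases "s \<le> b")
    case True
    then consider "s = 0" "b = 0" | b' where "s = 0" "b = Suc b'"
      | b' where "s = 1" "b = Suc b'" | s' b' where "s = Suc (Suc s')" "b = Suc b'"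
      by (cases b; cases s; cases "s - 1") auto
    then show ?thesis
    proof cases
      case 1
      then show ?thesis using Suc.IH[of 0 0] by (simp add: card_queue_paths_Suc)
    next
      case 2
      then show ?thesis using Suc.IH[of 0 b] Suc.IH[of 0 b'] by (simp add: card_queue_paths_Suc)
    next
      case 3
      then show ?thesis
        using Suc.IH[of 1 b] Suc.IH[of 1 b'] Suc.IH[of 0 b] Suc.IH[of 0 b']
        by (simp add: card_queue_paths_Suc algebra_simps)
    next
      case 4
      then show ?thesis
        using Suc.IH[of s b] Suc.IH[of s b'] Suc.IH[of "s - 1" b] Suc.IH[of "s - 1" b'] True
        by (simp add: card_queue_paths_Suc algebra_simps)
    qed
  next
    case False
    \<comment> \<open>On this boundary both sides vanish: arrivals would outnumber services.\<close>
    then have s: "s = Suc b" using Suc.prems by simp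
    have "queue_paths (Suc m) s b = {}"
    proof -
      have *: "arrivals xs \<le> services xs" if "queue_run 0 xs = 0" for xs
        using that queue_run_Cons_eq_0 by (cases xs) auto
      then show ?thesis using s by (auto simp: queue_paths_def dest!: *)
    qed
    then show ?thesis using s by simp
  qed
qed

section \<open>Two-column tableaux as queue histories\<close>

lemma less_card_atMost_iff:
  fixes xs :: "nat list"
  assumes "sorted_wrt (<) xs"
  shows "i < card (set xs \<inter> {..k}) \<longleftrightarrow> i < length xs \<and> xs ! i \<le> k"
  using assms
proof (induction xs arbitrary: i)
  case (Cons x xs)
  show ?case
  proof (cases "x \<le> k")
    case True
    have "x \<notin> set xs" using Cons.prems by auto
    then have "card (set (x # xs) \<inter> {..k}) = Suc (card (set xs \<inter> {..k}))"
      using True by (simp add: Int_insert_left)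
    then show ?thesis using Cons True by (cases i) auto
  next
    case False
    then have "set (x # xs) \<inter> {..k} = {}" using Cons.prems by fastforce
    moreover have "\<forall>y\<in>set (x # xs). k < y" using False Cons.prems by auto
    then have "\<not> (x # xs) ! i \<le> k" if "i < length (x # xs)"
      using nth_mem[OF that] by (meson leD)
    ultimately show ?thesis by auto
  qed
qed simp

text \<open>Since entry \<open>i\<close> is at most \<open>k\<close> exactly when more than
  \<open>i\<close> entries are, the row condition becomes a comparison of counting functions, which
  can be matched with arrivals and services.\<close>

lemma columns_dominated_iff:
  fixes xs ys :: "nat list"
  assumes "sorted_wrt (<) xs" "sorted_wrt (<) ys" "length ys \<le> length xs"
  shows "(\<forall>i<length ys. xs ! i \<le> ys ! i) \<longleftrightarrow>
    (\<forall>k. card (set ys \<inter> {..k}) \<le> card (set xs \<inter> {..k}))"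
proof
  assume dom: "\<forall>i<length ys. xs ! i \<le> ys ! i"
  show "\<forall>k. card (set ys \<inter> {..k}) \<le> card (set xs \<inter> {..k})"
  proof (intro allI leI notI)
    fix k assume "card (set xs \<inter> {..k}) < card (set ys \<inter> {..k})"
    \<comment> \<open>At index \<open>card (set xs \<inter> {..k})\<close> the entry of
      \<open>ys\<close> is at most \<open>k\<close> and that of \<open>xs\<close> exceeds
      \<open>k\<close>.\<close>
    then show False
      using dom assms less_card_atMost_iff[of xs "card (set xs \<inter> {..k})" k]
        less_card_atMost_iff[of ys "card (set xs \<inter> {..k})" k] by fastforce
  qed
next
  assume "\<forall>k. card (set ys \<inter> {..k}) \<le> card (set xs \<inter> {..k})"
  then show "\<forall>i<length ys. xs ! i \<le> ys ! i"
    using assms less_card_atMost_iff by (meson le_refl less_le_trans)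
qed

section \<open>Tableaux as pairs of lists\<close>

definition column :: "nat \<Rightarrow> nat \<Rightarrow> (nat \<times> nat \<Rightarrow> nat) \<Rightarrow> nat list" where
  "column c h T = map (\<lambda>x. T (x, c)) [1..<Suc h]"

lemma length_column [simp]: "length (column c h T) = h"
  by (simp add: column_def)

lemma set_column: "set (column c h T) = (\<lambda>x. T (x, c)) ` {1..h}"
  by (simp add: column_def atLeastLessThanSuc_atLeastAtMost del: upt_Suc)

lemma nth_column: "i < h \<Longrightarrow> column c h T ! i = T (Suc i, c)"
  by (simp add: column_def del: upt_Suc)

lemma semistandard_two_columns_iff:
  assumes "l \<le> r"
  shows "semistandard (two_columns r l) T \<and> (\<forall>b\<in>two_columns r l. T b \<le> m) \<longleftrightarrow>
    (\<forall>b. b \<notin> two_columns r l \<longrightarrow> T b = 0) \<and>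
    sorted_wrt (<) (column 1 r T) \<and> sorted_wrt (<) (column 2 l T) \<and>
    set (column 1 r T) \<subseteq> {1..m} \<and> set (column 2 l T) \<subseteq> {1..m} \<and>
    (\<forall>i<l. column 1 r T ! i \<le> column 2 l T ! i)"
proof -
  have srt: "sorted_wrt (<) (column c h T) \<longleftrightarrow>
      (\<forall>x x'. x \<in> {1..h} \<longrightarrow> x' \<in> {1..h} \<longrightarrow> x < x' \<longrightarrow> T (x, c) < T (x', c))" for c h
  proof -
    have "sorted_wrt (<) (column c h T) \<longleftrightarrow> (\<forall>j<h. \<forall>i<j. T (Suc i, c) < T (Suc j, c))"
      by (auto simp: sorted_wrt_iff_nth_less nth_column)
    also have "\<dots> \<longleftrightarrow> (\<forall>x x'. x \<in> {1..h} \<longrightarrow> x' \<in> {1..h} \<longrightarrow> x < x' \<longrightarrow> T (x, c) < T (x', c))"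
    proof (intro iffI allI impI)
      fix x x' assume *: "\<forall>j<h. \<forall>i<j. T (Suc i, c) < T (Suc j, c)"
        and x: "x \<in> {1..h}" "x' \<in> {1..h}" "x < x'"
      show "T (x, c) < T (x', c)"
        using *[rule_format, of "x' - 1" "x - 1"] x by auto
    qed auto
    finally show ?thesis .
  qed
  have dom: "(\<forall>i<l. column 1 r T ! i \<le> column 2 l T ! i) \<longleftrightarrow> (\<forall>x\<in>{1..l}. T (x, 1) \<le> T (x, 2))"
  proof -
    have "(\<forall>i<l. column 1 r T ! i \<le> column 2 l T ! i) \<longleftrightarrow> (\<forall>i<l. T (Suc i, 1) \<le> T (Suc i, 2))"
      using assms by (auto simp: nth_column)
    also have "\<dots> \<longleftrightarrow> (\<forall>x\<in>{1..l}. T (x, 1) \<le> T (x, 2))"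
      by (metis Suc_le_eq Suc_le_mono Suc_pred' atLeastAtMost_iff le0 One_nat_def)
    finally show ?thesis .
  qed
  show ?thesis
    unfolding srt dom set_column semistandard_def two_columns_def
    using assms by (fastforce simp: image_subset_iff)
qed

definition tableau_of :: "nat \<Rightarrow> nat \<Rightarrow> nat list \<times> nat list \<Rightarrow> nat \<times> nat \<Rightarrow> nat" where
  "tableau_of r l = (\<lambda>(xs, ys) (x, y).
     if (x, y) \<notin> two_columns r l then 0 else if y = 1 then xs ! (x - 1) else ys ! (x - 1))"

lemma column_tableau_of:
  assumes "length xs = r" "length ys = l"
  shows "column 1 r (tableau_of r l (xs, ys)) = xs" "column 2 l (tableau_of r l (xs, ys)) = ys"
  using assms by (auto intro!: nth_equalityI simp: nth_column tableau_of_def two_columns_def)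

text \<open>A filling extended by 0 is determined by its two columns, and
  \<open>columns_dominated_iff\<close> rephrases the row condition.\<close>

lemma Y_eq_card_lists:
  assumes "l \<le> r"
  shows "Y r l \<beta> m = card {(xs, ys). length xs = r \<and> length ys = l \<and>
    sorted_wrt (<) xs \<and> sorted_wrt (<) ys \<and> set xs \<subseteq> {1..m} \<and> set ys \<subseteq> {1..m} \<and>
    (\<forall>k. card (set ys \<inter> {..k}) \<le> card (set xs \<inter> {..k})) \<and> \<beta> \<in> set ys}"
    (is "_ = card ?P")
proof -
  let ?Q = "{T. semistandard (two_columns r l) T \<and> (\<forall>b \<in> two_columns r l. T b \<le> m) \<and>
                    (\<exists>x \<in> {1..l}. T (x, 2) = \<beta>)}"
  have Q: "T \<in> ?Q \<longleftrightarrow> (\<forall>b. b \<notin> two_columns r l \<longrightarrow> T b = 0) \<and> (column 1 r T, column 2 l T) \<in> ?P" for T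
  proof -
    have "T \<in> ?Q \<longleftrightarrow> (semistandard (two_columns r l) T \<and> (\<forall>b \<in> two_columns r l. T b \<le> m)) \<and>
        \<beta> \<in> set (column 2 l T)"
      by (auto simp: set_column)
    then show ?thesis
      unfolding semistandard_two_columns_iff[OF assms]
      using columns_dominated_iff[of "column 1 r T" "column 2 l T"] assms by auto
  qed
  have "bij_betw (\<lambda>T. (column 1 r T, column 2 l T)) ?Q ?P"
  proof (rule bij_betw_byWitness[where f' = "tableau_of r l"])
    show "\<forall>T\<in>?Q. tableau_of r l (column 1 r T, column 2 l T) = T"
    proof
      fix T assume "T \<in> ?Q"
      then have "T b = 0" if "b \<notin> two_columns r l" for b using Q that by blast
      then show "tableau_of r l (column 1 r T, column 2 l T) = T"
        by (auto simp: tableau_of_def fun_eq_iff two_columns_def nth_column)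
    qed
    show "\<forall>p\<in>?P. (column 1 r (tableau_of r l p), column 2 l (tableau_of r l p)) = p"
      using column_tableau_of by auto
    show "(\<lambda>T. (column 1 r T, column 2 l T)) ` ?Q \<subseteq> ?P"
      using Q by blast
    show "tableau_of r l ` ?P \<subseteq> ?Q"
    proof
      fix T assume "T \<in> tableau_of r l ` ?P"
      then obtain xs ys where xy: "(xs, ys) \<in> ?P" and T: "T = tableau_of r l (xs, ys)" by auto
      have cols: "column 1 r T = xs" "column 2 l T = ys"
        using column_tableau_of[of xs r ys l] xy T by auto
      have "\<forall>b. b \<notin> two_columns r l \<longrightarrow> T b = 0"
        by (auto simp: T tableau_of_def)
      then show "T \<in> ?Q" unfolding Q cols using xy by (rule conjI)
    qed
  qed
  then show ?thesis
    using assms bij_betw_same_card unfolding Y_def by auto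
qed

text \<open>Both columns of a tableau are recorded by complements: an entry is a time step without an
  arrival (first column) or without a service (second column).\<close>

definition gaps :: "('a \<Rightarrow> bool) \<Rightarrow> 'a list \<Rightarrow> nat list" where
  "gaps f zs = filter (\<lambda>k. \<not> f (zs ! (k - 1))) [1..<Suc (length zs)]"

lemma sorted_gaps: "sorted_wrt (<) (gaps f zs)"
  unfolding gaps_def by (intro sorted_wrt_filter) (simp del: upt_Suc)

lemma set_gaps: "set (gaps f zs) = {k \<in> {1..length zs}. \<not> f (zs ! (k - 1))}"
  by (auto simp: gaps_def simp del: upt_Suc)

text \<open>Each of the first \<open>k\<close> steps is either a gap or satisfies \<open>f\<close>.
  Passing to complements therefore reverses the comparison of counts.\<close>

lemma card_gaps_atMost:
  "card (set (gaps f zs) \<inter> {..k}) + length (filter f (take k zs)) = min k (length zs)"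
proof -
  have "length (filter f (take k zs)) = card {i. i < min k (length zs) \<and> f (zs ! i)}"
    unfolding length_filter_conv_card by (intro arg_cong[of _ _ card]) (auto simp: min_def)
  also have "\<dots> = card (Suc ` {i. i < min k (length zs) \<and> f (zs ! i)})"
    by (simp add: card_image)
  also have "card (set (gaps f zs) \<inter> {..k}) + \<dots> =
      card ((set (gaps f zs) \<inter> {..k}) \<union> Suc ` {i. i < min k (length zs) \<and> f (zs ! i)})"
    by (intro card_Un_disjoint[symmetric]) (auto simp: set_gaps)
  also have "(set (gaps f zs) \<inter> {..k}) \<union> Suc ` {i. i < min k (length zs) \<and> f (zs ! i)} =
      {1..min k (length zs)}"
  proof (intro equalityI subsetI)
    fix x assume "x \<in> {1..min k (length zs)}"
    then show "x \<in> (set (gaps f zs) \<inter> {..k}) \<union> Suc ` {i. i < min k (length zs) \<and> f (zs ! i)}"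
      by (cases x) (auto simp: set_gaps)
  qed (auto simp: set_gaps)
  finally show ?thesis by simp
qed

lemma length_gaps: "length (gaps f zs) + length (filter f zs) = length zs"
proof -
  have "card (set (gaps f zs)) = length (gaps f zs)"
    by (intro distinct_card) (simp add: gaps_def del: upt_Suc)
  moreover have "set (gaps f zs) \<inter> {..length zs} = set (gaps f zs)" by (auto simp: set_gaps)
  ultimately show ?thesis using card_gaps_atMost[of f zs "length zs"] by simp
qed

definition ungaps :: "nat \<Rightarrow> nat list \<times> nat list \<Rightarrow> (bool \<times> bool) list" where
  "ungaps m p = map (\<lambda>k. (k \<notin> set (fst p), k \<notin> set (snd p))) [1..<Suc m]"

lemma length_ungaps [simp]: "length (ungaps m p) = m"
  by (simp add: ungaps_def)

lemma nth_ungaps: "i < m \<Longrightarrow> ungaps m p ! i = (Suc i \<notin> set (fst p), Suc i \<notin> set (snd p))"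
  by (simp add: ungaps_def del: upt_Suc)

lemma gaps_ungaps:
  assumes "sorted_wrt (<) (fst p)" "sorted_wrt (<) (snd p)" "set (fst p) \<subseteq> {1..m}" "set (snd p) \<subseteq> {1..m}"
  shows "gaps fst (ungaps m p) = fst p" "gaps snd (ungaps m p) = snd p"
proof -
  have "set (gaps fst (ungaps m p)) = {k \<in> {1..m}. k \<in> set (fst p)}"
    "set (gaps snd (ungaps m p)) = {k \<in> {1..m}. k \<in> set (snd p)}"
    by (auto simp: set_gaps nth_ungaps)
  then have "set (gaps fst (ungaps m p)) = set (fst p)" "set (gaps snd (ungaps m p)) = set (snd p)"
    using assms(3,4) by blast+
  then show "gaps fst (ungaps m p) = fst p" "gaps snd (ungaps m p) = snd p"
    using assms(1,2) by (auto intro: strict_sorted_equal sorted_gaps)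
qed

text \<open>Two bijections are composed: complements turn the columns into sequences whose services
  dominate the arrivals in every prefix, and reversal turns these into histories that end with an
  empty queue.\<close>

lemma Y_eq_card_queue:
  assumes "l \<le> r" "r \<le> m" "\<beta> \<in> {1..m}"
  shows "Y r l \<beta> m = card {xs. length xs = m \<and> queue_run 0 xs = 0 \<and>
    arrivals xs = m - r \<and> services xs = m - l \<and> \<not> snd (xs ! (m - \<beta>))}"
    (is "_ = card ?A")
proof -
  let ?B = "{zs. length zs = m \<and> (\<forall>k. arrivals (take k zs) \<le> services (take k zs)) \<and>
    arrivals zs = m - r \<and> services zs = m - l \<and> \<not> snd (zs ! (\<beta> - 1))}"
  let ?P = "{(xs, ys). length xs = r \<and> length ys = l \<and>
    sorted_wrt (<) xs \<and> sorted_wrt (<) ys \<and> set xs \<subseteq> {1..m} \<and> set ys \<subseteq> {1..m} \<and>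
    (\<forall>k. card (set ys \<inter> {..k}) \<le> card (set xs \<inter> {..k})) \<and> \<beta> \<in> set ys}"
  have B: "zs \<in> ?B \<longleftrightarrow> (gaps fst zs, gaps snd zs) \<in> ?P" if "length zs = m" for zs
  proof -
    have dom: "(\<forall>k. card (set (gaps snd zs) \<inter> {..k}) \<le> card (set (gaps fst zs) \<inter> {..k})) \<longleftrightarrow>
        (\<forall>k. arrivals (take k zs) \<le> services (take k zs))"
    proof (intro all_cong1)
      fix k
      show "card (set (gaps snd zs) \<inter> {..k}) \<le> card (set (gaps fst zs) \<inter> {..k}) \<longleftrightarrow>
        arrivals (take k zs) \<le> services (take k zs)"
        using card_gaps_atMost[of fst zs k] card_gaps_atMost[of snd zs k] by linarith
    qed
    have "length (gaps fst zs) = r \<longleftrightarrow> arrivals zs = m - r"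
      "length (gaps snd zs) = l \<longleftrightarrow> services zs = m - l"
      using length_gaps[of fst zs] length_gaps[of snd zs] assms that by linarith+
    then show ?thesis
      using that assms(3) dom by (auto simp: sorted_gaps set_gaps)
  qed
  have "bij_betw (\<lambda>zs. (gaps fst zs, gaps snd zs)) ?B ?P"
  proof (rule bij_betw_byWitness[where f' = "ungaps m"])
    show "\<forall>zs\<in>?B. ungaps m (gaps fst zs, gaps snd zs) = zs"
      by (auto intro!: nth_equalityI simp: nth_ungaps set_gaps prod_eq_iff)
    show p: "\<forall>p\<in>?P. (gaps fst (ungaps m p), gaps snd (ungaps m p)) = p"
      using gaps_ungaps by auto
    show "(\<lambda>zs. (gaps fst zs, gaps snd zs)) ` ?B \<subseteq> ?P" using B by blast
    show "ungaps m ` ?P \<subseteq> ?B"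
    proof
      fix zs assume "zs \<in> ungaps m ` ?P"
      then obtain p where "p \<in> ?P" "zs = ungaps m p" by blast
      then show "zs \<in> ?B" using B[of zs] p by simp
    qed
  qed
  moreover have "bij_betw rev ?A ?B"
  proof (rule bij_betw_byWitness[where f' = rev])
    \<comment> \<open>Tableau entries number the steps from 1 and backwards, so entry \<beta> sits
      at forward index m - \<beta>.\<close>
    have *: "\<not> snd (xs ! (m - \<beta>)) \<longleftrightarrow> \<not> snd (rev xs ! (\<beta> - 1))" if "length xs = m" for xs
    proof -
      have "\<beta> - 1 < length xs" "length xs - Suc (\<beta> - 1) = m - \<beta>" using that assms(3) by auto
      then show ?thesis using rev_nth[of "\<beta> - 1" xs] by simp
    qed
    have A: "xs \<in> ?A \<longleftrightarrow> rev xs \<in> ?B" for xs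
    proof (cases "length xs = m")
      case True
      then show ?thesis
        using *[OF True] queue_run_rev_eq_0[of "rev xs"]
        by (simp only: mem_Collect_eq length_rev rev_rev_ident rev_filter[symmetric])
    qed simp
    show "rev ` ?A \<subseteq> ?B" using A by blast
    show "rev ` ?B \<subseteq> ?A" using A by (metis (no_types, lifting) image_subsetI rev_rev_ident)
  qed simp_all
  ultimately show ?thesis
    using Y_eq_card_lists[OF assms(1), of \<beta> m] by (metis (no_types, lifting) bij_betw_same_card)
qed

section \<open>Two-point correlations\<close>

text \<open>The ring is opened at the 2 on site \<open>a\<close> and read from the next site
  onwards, so that site 1 lands at index \<open>n - a\<close> of the opened word. \<open>P\<close>
  and \<open>Q\<close> express one condition before and after opening.\<close>

lemma sum_ring_weight_2_at:
  assumes "n = s + Suc d + r" "a \<in> {1..n}"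
    and PQ: "\<And>u. length u = n - 1 \<Longrightarrow> P (drop (n - a) u @ 2 # take (n - a) u) \<longleftrightarrow> Q u"
  shows "(\<Sum>l | l \<in> permutations_of_multiset (class_content s (Suc d) r) \<and> l ! (a - 1) = 2 \<and> P l.
      ring_weight l) =
    (\<Sum>u\<in>{u \<in> permutations_of_multiset (class_content s d r). Q u}. queue_count u 0)"
proof (rule sum.reindex_bij_witness[of _ "\<lambda>u. drop (n - a) u @ 2 # take (n - a) u"
      "\<lambda>l. drop a l @ take (a - 1) l"])
  have content: "class_content s (Suc d) r = add_mset 2 (class_content s d r)"
    by (simp add: class_content_def)
  have size: "size (class_content s d r) = n - 1"
    using assms(1) by (simp add: class_content_def)
  {
    fix l assume l: "l \<in> {l. l \<in> permutations_of_multiset (class_content s (Suc d) r) \<and> l ! (a - 1) = 2 \<and> P l}"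
    then have mset: "mset l = class_content s (Suc d) r" by (simp add: permutations_of_multiset_def)
    have len: "length l = n"
      using arg_cong[OF mset, of size] assms(1) by (simp add: class_content_def)
    have split: "l = take (a - 1) l @ 2 # drop a l"
      using l len assms(2) id_take_nth_drop[of "a - 1" l] by auto
    then obtain x y where l_eq: "l = x @ 2 # y" and x: "take (a - 1) l = x" and y: "drop a l = y"
      by metis
    have lens: "length x = a - 1" "length y = n - a"
      using len assms(2) by (auto simp flip: x y simp: min_def)
    show "drop (n - a) (drop a l @ take (a - 1) l) @ 2 # take (n - a) (drop a l @ take (a - 1) l) = l"
      unfolding x y using l_eq lens by simp
    have "P l" using l by simp
    then have "Q (y @ x)"
      using PQ[of "y @ x"] l_eq lens assms(2) by simp
    moreover have "mset (y @ x) = class_content s d r"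
      using mset l_eq content by (simp add: union_commute)
    ultimately show "drop a l @ take (a - 1) l \<in> {u \<in> permutations_of_multiset (class_content s d r). Q u}"
      unfolding x y by (simp add: permutations_of_multiset_def)
    show "queue_count (drop a l @ take (a - 1) l) 0 = ring_weight l"
      unfolding x y unfolding l_eq by (simp add: ring_weight_split)
  }
  {
    fix u assume u: "u \<in> {u \<in> permutations_of_multiset (class_content s d r). Q u}"
    then have mset: "mset u = class_content s d r" by (simp add: permutations_of_multiset_def)
    then have len: "length u = n - 1" using size by (metis size_mset)
    obtain x y where u_eq: "u = y @ x" and x: "drop (n - a) u = x" and y: "take (n - a) u = y"
      by (metis append_take_drop_id)
    have lens: "length x = a - 1" "length y = n - a"
      using len assms(2) by (auto simp flip: x y)
    show "drop a (drop (n - a) u @ 2 # take (n - a) u) @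
        take (a - 1) (drop (n - a) u @ 2 # take (n - a) u) = u"
      unfolding x y using u_eq lens assms(2) by simp
    have "P (x @ 2 # y)" using u PQ[OF len] x y by simp
    moreover have "mset (x @ 2 # y) = class_content s (Suc d) r"
      using mset u_eq content by (simp add: union_commute)
    moreover have "(x @ 2 # y) ! (a - 1) = 2" using lens by (simp add: nth_append)
    ultimately show "drop (n - a) u @ 2 # take (n - a) u \<in>
        {l. l \<in> permutations_of_multiset (class_content s (Suc d) r) \<and> l ! (a - 1) = 2 \<and> P l}"
      unfolding x y by (simp add: permutations_of_multiset_def)
  }
qed

text \<open>Letter 3 at site 1 is a missing service at index n - a = (n - 1) - (a - 1) of the opened
  word, which makes \<open>a - 1\<close> the prescribed entry of the second column.\<close>

lemma sum_ring_weight_3_2: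
  assumes n: "n = s + Suc d + r" and a: "2 \<le> a" "a \<le> n"
  shows "(\<Sum>l | l \<in> permutations_of_multiset (class_content s (Suc d) r) \<and> l ! (a - 1) = 2 \<and> l ! 0 = 3.
      ring_weight l) = Y (n - s - 1) r (a - 1) (n - 1)"
proof -
  have "(\<Sum>l | l \<in> permutations_of_multiset (class_content s (Suc d) r) \<and> l ! (a - 1) = 2 \<and> l ! 0 = 3.
      ring_weight l) =
      (\<Sum>u\<in>{u \<in> permutations_of_multiset (class_content s d r). u ! (n - a) = 3}. queue_count u 0)"
    by (rule sum_ring_weight_2_at[OF n]) (use a in \<open>auto simp: nth_append\<close>)
  also have "\<dots> = card {xs. length xs = s + d + r \<and> queue_run 0 xs = 0 \<and> arrivals xs = s \<and>
      services xs = s + d \<and> queue_letters 0 xs ! (n - a) = 3}"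
    by (rule sum_queue_count)
  also have "{xs. length xs = s + d + r \<and> queue_run 0 xs = 0 \<and> arrivals xs = s \<and>
      services xs = s + d \<and> queue_letters 0 xs ! (n - a) = 3} =
    {xs. length xs = n - 1 \<and> queue_run 0 xs = 0 \<and>
      arrivals xs = n - 1 - (n - s - 1) \<and> services xs = n - 1 - r \<and> \<not> snd (xs ! (n - 1 - (a - 1)))}"
  proof -
    have "s + d + r = n - 1" "n - 1 - (n - s - 1) = s" "n - 1 - r = s + d" "n - 1 - (a - 1) = n - a"
      using n a by auto
    moreover have "queue_letters 0 xs ! (n - a) = 3 \<longleftrightarrow> \<not> snd (xs ! (n - a))" if "length xs = n - 1" for xs
      using that a by (intro queue_letters_nth_3) auto
    ultimately show ?thesis by auto
  qed
  also have "card \<dots> = Y (n - s - 1) r (a - 1) (n - 1)"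
    by (rule Y_eq_card_queue[symmetric]) (use n a in auto)
  finally show ?thesis .
qed

text \<open>With t = s + d + 1, absorption identities express the binomials of n - 1 by those of n.
  After multiplication by n^2 the determinant collapses through (n - s) t - s (n - t) = n (t -
  s).\<close>

lemma card_queue_paths_times:
  assumes "n = s + Suc d + r"
  shows "n * card (queue_paths (n - 1) s (s + d)) = Suc d * (n choose s) * (n choose (s + Suc d))"
proof -
  define t where "t = s + Suc d"
  have n: "n > 0" "s \<le> n" "t \<le> n" "t > 0" using assms by (auto simp: t_def)
  have eqs: "int n * int (n - 1 choose s) = (int n - int s) * int (n choose s)"
    "int n * int (n - 1 choose (t - 1)) = int t * int (n choose t)"
    "int n * int (n - 1 choose t) = (int n - int t) * int (n choose t)"
    using arg_cong[OF binomial_absorb_comp[of n s], of int]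
      arg_cong[OF times_binomial_minus1_eq[of t n], of int]
      arg_cong[OF binomial_absorb_comp[of n t], of int] n
    by (simp_all add: of_nat_diff)
  have eq4: "int n * (if s = 0 then 0 else int (n - 1 choose (s - 1))) = int s * int (n choose s)"
  proof (cases "s = 0")
    case False
    then show ?thesis using arg_cong[OF times_binomial_minus1_eq[of s n], of int] by simp
  qed simp
  have "int (card (queue_paths (n - 1) s (s + d))) =
    int (n - 1 choose s) * int (n - 1 choose (t - 1)) -
    (if s = 0 then 0 else int (n - 1 choose (s - 1))) * int (n - 1 choose t)"
    using card_queue_paths[of s "s + d" "n - 1"] by (simp add: t_def)
  then have "int n * (int n * int (card (queue_paths (n - 1) s (s + d)))) =
    (int n * int (n - 1 choose s)) * (int n * int (n - 1 choose (t - 1))) -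
    (int n * (if s = 0 then 0 else int (n - 1 choose (s - 1)))) * (int n * int (n - 1 choose t))"
    by (simp only: right_diff_distrib mult_ac)
  also have "\<dots> = int n * (int (Suc d) * int (n choose s) * int (n choose t))"
    unfolding eqs eq4 by (simp add: t_def algebra_simps)
  finally have "int n * int (card (queue_paths (n - 1) s (s + d))) =
      int (Suc d) * int (n choose s) * int (n choose t)"
    using n by simp
  then show ?thesis unfolding t_def by (metis of_nat_eq_iff of_nat_mult)
qed

text \<open>Double counting of words with a marked 2: each word has \<open>Suc d\<close> of them,
  and each of the \<open>n\<close> sites contributes the same number of queue histories.\<close>

lemma sum_ring_weight:
  assumes n: "n = s + Suc d + r"
  shows "(\<Sum>l\<in>permutations_of_multiset (class_content s (Suc d) r). ring_weight l) =
    (n choose s) * (n choose (s + Suc d))"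
proof -
  let ?W = "permutations_of_multiset (class_content s (Suc d) r)"
  have num2: "(\<Sum>a = 1..n. of_bool (l ! (a - 1) = 2)) = Suc d" if "l \<in> ?W" for l
  proof -
    have m: "mset l = class_content s (Suc d) r" using that by (simp add: permutations_of_multiset_def)
    have len: "length l = n" using arg_cong[OF m, of size] n by (simp add: class_content_def)
    have "(\<Sum>a = 1..n. of_bool (l ! (a - 1) = 2)) = (\<Sum>i<n. of_bool (l ! i = 2))"
      by (rule sum.reindex_bij_witness[of _ Suc "\<lambda>a. a - 1"]) auto
    also have "\<dots> = card {i. i < n \<and> l ! i = 2}"
      by (simp add: sum_of_bool_eq Int_def lessThan_def conj_commute)
    also have "\<dots> = count (mset l) 2"
      using len by (simp add: count_mset count_list_eq_length_filter length_filter_conv_card eq_commute)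
    finally show ?thesis using m by (simp add: class_content_def)
  qed
  have at: "(\<Sum>l\<in>?W. of_bool (l ! (a - 1) = 2) * ring_weight l) = card (queue_paths (n - 1) s (s + d))"
    if a: "a \<in> {1..n}" for a
  proof -
    have "(\<Sum>l\<in>?W. of_bool (l ! (a - 1) = 2) * ring_weight l) =
        (\<Sum>l | l \<in> ?W \<and> l ! (a - 1) = 2 \<and> True. ring_weight l)"
      by (intro sum.mono_neutral_cong_right) auto
    also have "\<dots> = (\<Sum>u\<in>{u \<in> permutations_of_multiset (class_content s d r). True}. queue_count u 0)"
      by (rule sum_ring_weight_2_at[OF n a]) simp
    also have "\<dots> = card (queue_paths (n - 1) s (s + d))"
      unfolding sum_queue_count using n by (simp add: queue_paths_def)
    finally show ?thesis .
  qed
  have "Suc d * (\<Sum>l\<in>?W. ring_weight l) =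
      (\<Sum>l\<in>?W. \<Sum>a = 1..n. of_bool (l ! (a - 1) = 2) * ring_weight l)"
    by (simp only: sum_distrib_left sum_distrib_right[symmetric] num2 cong: sum.cong)
  also have "\<dots> = (\<Sum>a = 1..n. \<Sum>l\<in>?W. of_bool (l ! (a - 1) = 2) * ring_weight l)"
    by (rule sum.swap)
  also have "\<dots> = n * card (queue_paths (n - 1) s (s + d))"
    using at by simp
  also have "\<dots> = Suc d * ((n choose s) * (n choose (s + Suc d)))"
    using card_queue_paths_times[OF n] by (simp only: mult.assoc)
  finally show ?thesis unfolding mult_cancel1 by simp
qed

lemma ring_stationary_ring_weight:
  assumes "n \<ge> 2" "n = s + Suc d + r"
  shows "ring_stationary n (permutations_of_multiset (class_content s (Suc d) r))
    (\<lambda>l. real (ring_weight l))"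
proof (rule ring_stationaryI)
  fix l assume "l \<in> permutations_of_multiset (class_content s (Suc d) r)"
  then have m: "mset l = class_content s (Suc d) r" by (simp add: permutations_of_multiset_def)
  have "set_mset (mset l) \<subseteq> {1, 2, 3}" "2 \<in> set_mset (mset l)"
    unfolding m by (auto simp: class_content_def split: if_splits)
  moreover have "length l = n"
    using arg_cong[OF m, of size] assms by (simp add: class_content_def)
  ultimately show "(\<Sum>k = 1..n. flux (\<lambda>l. real (ring_weight l)) l (ring_swap n k l)
      (l ! (left_site n k - 1)) (l ! (k - 1))) = 0"
    using assms(1) by (intro ring_weight_balance) auto
qed (use assms in \<open>auto simp: class_content_def\<close>)

section \<open>From ring weights to probabilities\<close>

lemma prob_eq_sum_tasep_states:
  assumes "tasep_stationary n \<pi>"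
  shows "measure_pmf.prob \<pi> A = (\<Sum>w\<in>tasep_states n. pmf \<pi> w * of_bool (w \<in> A))"
proof -
  have "measure_pmf.prob \<pi> A = measure_pmf.prob \<pi> (A \<inter> tasep_states n)"
    using assms by (intro measure_prob_cong_0) (auto simp: tasep_stationary_def set_pmf_iff)
  also have "\<dots> = (\<Sum>w\<in>A \<inter> tasep_states n. pmf \<pi> w)"
    by (rule measure_measure_pmf_finite) (simp add: finite_tasep_states)
  also have "\<dots> = (\<Sum>w\<in>tasep_states n. pmf \<pi> w * of_bool (w \<in> A))"
    by (rule sum.mono_neutral_cong_left) (auto simp: finite_tasep_states)
  finally show ?thesis .
qed

lemma prob_class_3_2:
  assumes n: "n \<ge> 2" and a: "2 \<le> a" "a \<le> n" and st: "s \<le> t" "s < n" "t \<le> n"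
    and \<pi>: "tasep_stationary n \<pi>"
  shows "(\<Sum>w\<in>tasep_states n. pmf \<pi> w * of_bool (t < w 1 \<and> s < w a \<and> w a \<le> t)) =
    real (Y (n - s - 1) (n - t) (a - 1) (n - 1)) / (real (n choose s) * real (n choose t))"
proof (cases "s = t")
  \<comment> \<open>The event is empty, and \<open>Y\<close> is 0 by convention since its first
    column would be shorter than its second. This case occurs in the final formula when j = i +
    1.\<close>
  case True
  then have "(\<Sum>w\<in>tasep_states n. pmf \<pi> w * of_bool (t < w 1 \<and> s < w a \<and> w a \<le> t)) = 0"
    by (intro sum.neutral) auto
  moreover have "n - s - 1 < n - t" using True st by simp
  ultimately show ?thesis by (simp add: Y_def)
next
  case False
  define d r where "d = t - s - 1" and "r = n - t"
  have nt: "n = s + Suc d + r" "t = s + Suc d" "t - s = Suc d" using False st by (auto simp: d_def r_def)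
  let ?S = "tasep_states n" and ?c = "class_word n s t"
    and ?W = "permutations_of_multiset (class_content s (Suc d) r)"
  have content: "class_content s (t - s) (n - t) = class_content s (Suc d) r"
    by (simp only: nt(3) r_def)
  define f where "f l = (\<Sum>w | w \<in> ?S \<and> ?c w = l. pmf \<pi> w)" for l
  have c_in: "?c w \<in> ?W" if "w \<in> ?S" for w
    using mset_class_word[OF that st(1,3)] unfolding content by (rule permutations_of_multisetI)
  have "ring_stationary n ?W f"
    using ring_stationary_class_word[OF \<pi> st(1,3)] unfolding f_def content .
  moreover have "size (class_content s (Suc d) r) = n" using nt(1) by (simp add: class_content_def)
  ultimately have "f l * real (ring_weight l') = f l' * real (ring_weight l)"
    if "l \<in> ?W" "l' \<in> ?W" for l l'
    using ring_stationary_unique[OF n _ _ ring_stationary_ring_weight[OF n nt(1)] _ that]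
      ring_weight_pos by simp
  \<comment> \<open>Summing the proportionality over \<open>l'\<close> determines the constant,
    because \<open>f\<close> has total mass 1.\<close>
  then have "(\<Sum>l'\<in>?W. f l * real (ring_weight l')) = (\<Sum>l'\<in>?W. f l' * real (ring_weight l))"
    if "l \<in> ?W" for l
    using that by (intro sum.cong) auto
  then have "f l * real (\<Sum>l'\<in>?W. ring_weight l') = (\<Sum>l'\<in>?W. f l') * real (ring_weight l)"
    if "l \<in> ?W" for l
    using that by (simp add: sum_distrib_left sum_distrib_right)
  moreover have "(\<Sum>l'\<in>?W. f l') = 1"
  proof -
    have "(\<Sum>l'\<in>?W. f l') = (\<Sum>w\<in>?S. pmf \<pi> w)"
      unfolding f_def by (rule sum.group) (use c_in in \<open>auto simp: finite_tasep_states\<close>)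
    also have "\<dots> = 1"
      using \<pi> by (intro sum_pmf_eq_1) (auto simp: tasep_stationary_def finite_tasep_states)
    finally show ?thesis .
  qed
  moreover have "real (\<Sum>l'\<in>?W. ring_weight l') = real (n choose s) * real (n choose t)"
    using sum_ring_weight[OF nt(1)] nt(2) by simp
  ultimately have f: "f l = real (ring_weight l) / (real (n choose s) * real (n choose t))"
    if "l \<in> ?W" for l
    using that st by (simp add: field_simps)
  have event: "t < w 1 \<and> s < w a \<and> w a \<le> t \<longleftrightarrow> ?c w ! (a - 1) = 2 \<and> ?c w ! 0 = 3" for w
    using nth_class_word[of 1 n s t w] nth_class_word[of a n s t w] a st
    by (auto simp: species_class_def split: if_splits)
  have "(\<Sum>w\<in>?S. pmf \<pi> w * of_bool (t < w 1 \<and> s < w a \<and> w a \<le> t)) =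
      (\<Sum>w\<in>?S. pmf \<pi> w * of_bool (?c w ! (a - 1) = 2 \<and> ?c w ! 0 = 3))"
    unfolding event ..
  also have "\<dots> = (\<Sum>l\<in>?W. \<Sum>w | w \<in> ?S \<and> ?c w = l.
      pmf \<pi> w * of_bool (?c w ! (a - 1) = 2 \<and> ?c w ! 0 = 3))"
    by (rule sum.group[symmetric]) (use c_in in \<open>auto simp: finite_tasep_states\<close>)
  also have "\<dots> = (\<Sum>l\<in>?W. f l * of_bool (l ! (a - 1) = 2 \<and> l ! 0 = 3))"
    unfolding f_def sum_distrib_right by (intro sum.cong) auto
  also have "\<dots> = (\<Sum>l | l \<in> ?W \<and> l ! (a - 1) = 2 \<and> l ! 0 = 3.
      real (ring_weight l) / (real (n choose s) * real (n choose t)))"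
    by (rule sum.mono_neutral_cong_right) (auto simp: f)
  also have "\<dots> = real (\<Sum>l | l \<in> ?W \<and> l ! (a - 1) = 2 \<and> l ! 0 = 3. ring_weight l) /
      (real (n choose s) * real (n choose t))"
    by (simp add: sum_divide_distrib)
  finally show ?thesis
    unfolding sum_ring_weight_3_2[OF nt(1) a] unfolding r_def .
qed

theorem theorem5p1:
  fixes n a i j :: nat and \<pi> :: "(nat \<Rightarrow> nat) pmf"
  assumes "n \<ge> 2" and "2 \<le> a" and "a \<le> n" and "1 \<le> i" and "i < j" and "j \<le> n"
    and "tasep_stationary n \<pi>"
  shows "measure_pmf.prob \<pi> {w. w 1 = j \<and> w a = i} =
      real (Y (n - i) (n - j + 1) (a - 1) (n - 1))
        / (real (n choose (i - 1)) * real (n choose (j - 1)))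
    - real (Y (n - i) (n - j) (a - 1) (n - 1))
        / (real (n choose (i - 1)) * real (n choose j))
    - real (Y (n - i - 1) (n - j + 1) (a - 1) (n - 1))
        / (real (n choose i) * real (n choose (j - 1)))
    + real (Y (n - i - 1) (n - j) (a - 1) (n - 1))
        / (real (n choose i) * real (n choose j))"
proof -
  define H where "H s t = (\<Sum>w\<in>tasep_states n. pmf \<pi> w * of_bool (t < w 1 \<and> s < w a \<and> w a \<le> t))" for s t
  \<comment> \<open>Differencing in the lower threshold isolates \<open>w a = i\<close>, as i is at
    most j - 1; differencing in the upper one then isolates \<open>w 1 = j\<close>.\<close>
  have "of_bool (w 1 = j \<and> w a = i) =
      (of_bool (j - 1 < w 1 \<and> i - 1 < w a \<and> w a \<le> j - 1) - of_bool (j < w 1 \<and> i - 1 < w a \<and> w a \<le> j)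
      - of_bool (j - 1 < w 1 \<and> i < w a \<and> w a \<le> j - 1) + of_bool (j < w 1 \<and> i < w a \<and> w a \<le> j) :: real)"
    for w :: "nat \<Rightarrow> nat"
    using assms(4,5) by (auto simp: of_bool_def)
  then have "measure_pmf.prob \<pi> {w. w 1 = j \<and> w a = i} =
      H (i - 1) (j - 1) - H (i - 1) j - H i (j - 1) + H i j"
    unfolding prob_eq_sum_tasep_states[OF assms(7)] H_def
    by (simp add: sum.distrib sum_subtractf distrib_left right_diff_distrib del: of_bool_conj)
  moreover have "n - (i - 1) - 1 = n - i" "n - (j - 1) = n - j + 1" using assms by auto
  ultimately show ?thesis
    using assms prob_class_3_2[OF assms(1-3) _ _ _ assms(7)] unfolding H_def by simp
qed

end
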